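(* Let $r$ be a positive integer. There are only finitely many (up to isomorphism) excluded minors of rank $r$ for the class of quasi-graphic matroids.
   Context: All matroids and graphs are finite; graphs may have loops and parallel edges. For a vertex $v$ of a graph $G$, $\mathrm{loops}(v)$ is the set of loops of $G$ incident to $v$. A framework for a matroid $M$ (with rank function $r_M$ and closure operator $\mathrm{cl}$) is a graph $G$ such that: (1) $E(G)=E(M)$; (2) for each component $H$ of $G$, $r_M(E(H))\le |V(H)|$; (3) for each vertex $v\in V(G)$, $\mathrm{cl}(E(G-v))\subseteq E(G-v)\cup \mathrm{loops}(v)$; (4) if $C$ is a circuit of $M$, then the subgraph of $G$ induced by the edge set $C$ has at most two components. A matroid is quasi-graphic if it has a framework. The class of quasi-graphic matroids is minor-closed. An excluded minor for a minor-closed class is a matroid that is not in the class but all of whose proper minors are in the class. *)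

theory Defs
  imports Main
begin

section \<open>Matroids\<close>

record 'a set_system =
  ground :: "'a set"
  indeps :: "'a set set"

locale matroid =
  fixes M :: "'a set_system"
  assumes finite_ground: "finite (ground M)"
    and indeps_subset: "I \<in> indeps M \<Longrightarrow> I \<subseteq> ground M"
    and empty_indep: "{} \<in> indeps M"
    and subset_indep: "I \<in> indeps M \<Longrightarrow> J \<subseteq> I \<Longrightarrow> J \<in> indeps M"
    and augment: "I \<in> indeps M \<Longrightarrow> J \<in> indeps M \<Longrightarrow> card I < card J
      \<Longrightarrow> \<exists>e\<in>J - I. insert e I \<in> indeps M"

definition rank_of :: "'a set_system \<Rightarrow> 'a set \<Rightarrow> nat" where
  "rank_of M X = Max (card ` {I \<in> indeps M. I \<subseteq> X})"

definition rank :: "'a set_system \<Rightarrow> nat" where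
  "rank M = rank_of M (ground M)"

definition closure_of :: "'a set_system \<Rightarrow> 'a set \<Rightarrow> 'a set" where
  "closure_of M X = {e \<in> ground M. rank_of M (insert e X) = rank_of M X}"

definition circuit :: "'a set_system \<Rightarrow> 'a set \<Rightarrow> bool" where
  "circuit M C \<longleftrightarrow> C \<subseteq> ground M \<and> C \<notin> indeps M \<and> (\<forall>D. D \<subset> C \<longrightarrow> D \<in> indeps M)"

definition delete :: "'a set_system \<Rightarrow> 'a set \<Rightarrow> 'a set_system" where
  "delete M D = \<lparr>ground = ground M - D, indeps = {I \<in> indeps M. I \<subseteq> ground M - D}\<rparr>"

text \<open>The rank function of \<open>contract M C\<close> is \<open>X \<mapsto> rank_of M (X \<union> C) - rank_of M C\<close>, and the
  independent sets are those whose cardinality equals their rank.\<close>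

definition contract :: "'a set_system \<Rightarrow> 'a set \<Rightarrow> 'a set_system" where
  "contract M C = \<lparr>ground = ground M - C,
     indeps = {I. I \<subseteq> ground M - C \<and> rank_of M (I \<union> C) = card I + rank_of M C}\<rparr>"

definition minor :: "'a set_system \<Rightarrow> 'a set_system \<Rightarrow> bool" where
  "minor N M \<longleftrightarrow> (\<exists>C D. C \<subseteq> ground M \<and> D \<subseteq> ground M \<and> C \<inter> D = {} \<and> N = delete (contract M C) D)"

definition proper_minor :: "'a set_system \<Rightarrow> 'a set_system \<Rightarrow> bool" where
  "proper_minor N M \<longleftrightarrow> minor N M \<and> N \<noteq> M"

definition excluded_minor :: "('a set_system \<Rightarrow> bool) \<Rightarrow> 'a set_system \<Rightarrow> bool" where
  "excluded_minor P M \<longleftrightarrow> matroid M \<and> \<not> P M \<and> (\<forall>N. proper_minor N M \<longrightarrow> P N)"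

definition isomorphic :: "'a set_system \<Rightarrow> 'b set_system \<Rightarrow> bool" where
  "isomorphic M N \<longleftrightarrow> (\<exists>f. bij_betw f (ground M) (ground N) \<and>
     (\<forall>X. X \<subseteq> ground M \<longrightarrow> (X \<in> indeps M \<longleftrightarrow> f ` X \<in> indeps N)))"

lemma equiv_isomorphic: "equiv UNIV {(M :: 'a set_system, N). isomorphic M N}"
proof (rule equivI)
  show "refl {(M :: 'a set_system, N). isomorphic M N}"
    unfolding refl_on_def isomorphic_def by (auto intro!: exI[of _ "\<lambda>x. x"] simp: bij_betw_def)
  show "sym {(M :: 'a set_system, N). isomorphic M N}"
  proof (rule symI, clarsimp)
    fix M N :: "'a set_system" assume "isomorphic M N"
    then obtain f where f: "bij_betw f (ground M) (ground N)"
      and I: "\<And>X. X \<subseteq> ground M \<Longrightarrow> X \<in> indeps M \<longleftrightarrow> f ` X \<in> indeps N"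
      unfolding isomorphic_def by blast
    let ?g = "inv_into (ground M) f"
    have g: "bij_betw ?g (ground N) (ground M)" using f by (rule bij_betw_inv_into)
    have "X \<in> indeps N \<longleftrightarrow> ?g ` X \<in> indeps M" if "X \<subseteq> ground N" for X
    proof -
      have "?g ` X \<subseteq> ground M" using g that by (auto simp: bij_betw_def)
      moreover have "f ` ?g ` X = X"
        using f that by (simp add: image_inv_into_cancel bij_betw_def)
      ultimately show ?thesis using I by simp
    qed
    with g show "isomorphic N M" unfolding isomorphic_def by blast
  qed
  show "trans {(M :: 'a set_system, N). isomorphic M N}"
  proof (rule transI, clarsimp)
    fix M N K :: "'a set_system" assume "isomorphic M N" "isomorphic N K"
    then obtain f g where f: "bij_betw f (ground M) (ground N)"
      and I: "\<And>X. X \<subseteq> ground M \<Longrightarrow> X \<in> indeps M \<longleftrightarrow> f ` X \<in> indeps N"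
      and g: "bij_betw g (ground N) (ground K)"
      and J: "\<And>X. X \<subseteq> ground N \<Longrightarrow> X \<in> indeps N \<longleftrightarrow> g ` X \<in> indeps K"
      unfolding isomorphic_def by metis
    have "X \<in> indeps M \<longleftrightarrow> (g \<circ> f) ` X \<in> indeps K" if "X \<subseteq> ground M" for X
    proof -
      have "f ` X \<subseteq> ground N" using f that by (auto simp: bij_betw_def)
      then show ?thesis using I[OF that] J by (simp add: image_comp)
    qed
    with bij_betw_trans[OF f g] show "isomorphic M K" unfolding isomorphic_def by blast
  qed
qed simp

context matroid
begin

lemma finite_indep: "I \<in> indeps M \<Longrightarrow> finite I"
  using indeps_subset finite_ground finite_subset by blast

lemma finite_indeps: "finite {I \<in> indeps M. I \<subseteq> X}"
  by (rule finite_subset[of _ "Pow (ground M)"]) (auto simp: finite_ground dest: indeps_subset)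

lemma card_le_rank_of: "I \<in> indeps M \<Longrightarrow> I \<subseteq> X \<Longrightarrow> card I \<le> rank_of M X"
  unfolding rank_of_def by (rule Max_ge) (auto intro: finite_indeps)

lemma rank_of_witness: "\<exists>B\<in>indeps M. B \<subseteq> X \<and> card B = rank_of M X"
proof -
  have "rank_of M X \<in> card ` {I \<in> indeps M. I \<subseteq> X}"
    unfolding rank_of_def by (rule Max_in) (use finite_indeps empty_indep in auto)
  then show ?thesis by auto
qed

lemma extend_indep:
  assumes "I \<in> indeps M" "I \<subseteq> X"
  shows "\<exists>B\<in>indeps M. I \<subseteq> B \<and> B \<subseteq> X \<and> card B = rank_of M X"
  using assms
proof (induction "rank_of M X - card I" arbitrary: I)
  case 0
  then show ?case using card_le_rank_of[of I X] by force
next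
  case (Suc n)
  obtain B where B: "B \<in> indeps M" "B \<subseteq> X" "card B = rank_of M X"
    using rank_of_witness by blast
  then obtain e where e: "e \<in> B - I" "insert e I \<in> indeps M"
    using augment[of I B] Suc.prems Suc.hyps(2) by (metis zero_less_Suc zero_less_diff)
  have "card (insert e I) = Suc (card I)" using e Suc finite_indep by auto
  then have "n = rank_of M X - card (insert e I)" using Suc by simp
  from Suc.hyps(1)[OF this e(2)] show ?case using e B Suc by auto
qed

lemma indep_contract_iff:
  assumes B: "B \<in> indeps M" "B \<subseteq> C" "card B = rank_of M C"
  shows "I \<in> indeps (contract M C) \<longleftrightarrow> I \<subseteq> ground M - C \<and> I \<union> B \<in> indeps M"
proof (cases "I \<subseteq> ground M - C")
  case True
  then have disj: "I \<inter> C = {}" and fin: "finite I" "finite B"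
    using B finite_indep finite_ground finite_subset by blast+
  obtain A where A: "A \<in> indeps M" "B \<subseteq> A" "A \<subseteq> I \<union> C" "card A = rank_of M (I \<union> C)"
    using extend_indep[OF B(1)] B(2) by blast
  have "card (A \<inter> C) \<le> card B"
    using card_le_rank_of[of "A \<inter> C" C] subset_indep[OF A(1)] B(3) by auto
  moreover have "B \<subseteq> A \<inter> C" "finite (A \<inter> C)" using A B finite_indep by auto
  ultimately have "A \<inter> C = B" by (metis card_seteq)
  then have AI: "A \<subseteq> I \<union> B" using A by auto
  have c: "card (I \<union> B) = card I + card B" using disj B fin by (intro card_Un_disjoint) auto
  have "rank_of M (I \<union> C) = card I + rank_of M C \<longleftrightarrow> I \<union> B \<in> indeps M"
  proof
    assume "rank_of M (I \<union> C) = card I + rank_of M C"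
    then have "A = I \<union> B" using AI A c B fin by (intro card_seteq) auto
    with A show "I \<union> B \<in> indeps M" by simp
  next
    assume "I \<union> B \<in> indeps M"
    then have "card (I \<union> B) \<le> rank_of M (I \<union> C)" using B by (intro card_le_rank_of) auto
    moreover have "card A \<le> card (I \<union> B)" using AI fin by (intro card_mono) auto
    ultimately show "rank_of M (I \<union> C) = card I + rank_of M C" using A B c by simp
  qed
  with True show ?thesis by (simp add: contract_def)
qed (simp add: contract_def)

lemma matroid_delete: "matroid (delete M D)"
proof
  fix I J assume "I \<in> indeps (delete M D)" "J \<in> indeps (delete M D)" "card I < card J"
  then show "\<exists>e\<in>J - I. insert e I \<in> indeps (delete M D)"
    using augment[of I J] by (auto simp: delete_def)
qed (auto simp: delete_def finite_ground empty_indep intro: subset_indep)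

lemma matroid_contract: "matroid (contract M C)"
proof -
  obtain B where B: "B \<in> indeps M" "B \<subseteq> C" "card B = rank_of M C"
    using rank_of_witness by blast
  note iff = indep_contract_iff[OF B]
  show ?thesis
  proof
    show "finite (ground (contract M C))" by (simp add: contract_def finite_ground)
    show "{} \<in> indeps (contract M C)" using B by (simp add: iff)
    show "I \<subseteq> ground (contract M C)" if "I \<in> indeps (contract M C)" for I
      using that by (simp add: contract_def)
    show "J \<in> indeps (contract M C)" if "I \<in> indeps (contract M C)" "J \<subseteq> I" for I J
      using that subset_indep[of "I \<union> B" "J \<union> B"] by (auto simp: iff)
    fix I J assume IJ: "I \<in> indeps (contract M C)" "J \<in> indeps (contract M C)" "card I < card J"
    have "card (K \<union> B) = card K + card B" if "K \<in> indeps (contract M C)" for K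
      using that B finite_indep[of "K \<union> B"] by (intro card_Un_disjoint) (auto simp: iff)
    then have "card (I \<union> B) < card (J \<union> B)" using IJ by simp
    then obtain e where "e \<in> (J \<union> B) - (I \<union> B)" "insert e (I \<union> B) \<in> indeps M"
      using augment[of "I \<union> B" "J \<union> B"] IJ by (auto simp: iff)
    then show "\<exists>e\<in>J - I. insert e I \<in> indeps (contract M C)"
      using IJ by (auto simp: iff)
  qed
qed

lemma matroid_minor: "minor N M \<Longrightarrow> matroid N"
  using matroid.matroid_delete[OF matroid_contract] by (auto simp: minor_def)

end

section \<open>Graphs with loops and parallel edges\<close>

text \<open>An edge is a loop iff its set of ends is a singleton.  The values of \<open>ends\<close> outside \<open>edges\<close>
  are irrelevant.\<close>

record ('v, 'e) pre_multigraph =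
  verts :: "'v set"
  edges :: "'e set"
  ends :: "'e \<Rightarrow> 'v set"

locale multigraph =
  fixes G :: "('v, 'e) pre_multigraph"
  assumes finite_verts: "finite (verts G)"
    and finite_edges: "finite (edges G)"
    and ends_subset: "e \<in> edges G \<Longrightarrow> ends G e \<subseteq> verts G"
    and card_ends: "e \<in> edges G \<Longrightarrow> card (ends G e) \<in> {1, 2}"

definition loops_at :: "('v, 'e) pre_multigraph \<Rightarrow> 'v \<Rightarrow> 'e set" where
  "loops_at G v = {e \<in> edges G. ends G e = {v}}"

definition induced_subgraph :: "('v, 'e) pre_multigraph \<Rightarrow> 'v set \<Rightarrow> ('v, 'e) pre_multigraph" where
  "induced_subgraph G W = \<lparr>verts = W, edges = {e \<in> edges G. ends G e \<subseteq> W}, ends = ends G\<rparr>"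

definition delete_vertex :: "('v, 'e) pre_multigraph \<Rightarrow> 'v \<Rightarrow> ('v, 'e) pre_multigraph" where
  "delete_vertex G v = induced_subgraph G (verts G - {v})"

definition edge_induced_subgraph ::
    "('v, 'e) pre_multigraph \<Rightarrow> 'e set \<Rightarrow> ('v, 'e) pre_multigraph" where
  "edge_induced_subgraph G C = \<lparr>verts = (\<Union>e\<in>C. ends G e), edges = C, ends = ends G\<rparr>"

definition adjacency :: "('v, 'e) pre_multigraph \<Rightarrow> ('v \<times> 'v) set" where
  "adjacency G = {(u, v). \<exists>e\<in>edges G. ends G e = {u, v}}"

definition components :: "('v, 'e) pre_multigraph \<Rightarrow> ('v, 'e) pre_multigraph set" where
  "components G = induced_subgraph G ` (verts G // (adjacency G)\<^sup>*)"

section \<open>Frameworks and quasi-graphic matroids\<close>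

definition framework :: "'a set_system \<Rightarrow> ('v, 'a) pre_multigraph \<Rightarrow> bool" where
  "framework M G \<longleftrightarrow> multigraph G \<and>
     edges G = ground M \<and>
     (\<forall>H\<in>components G. rank_of M (edges H) \<le> card (verts H)) \<and>
     (\<forall>v\<in>verts G. closure_of M (edges (delete_vertex G v))
        \<subseteq> edges (delete_vertex G v) \<union> loops_at G v) \<and>
     (\<forall>C. circuit M C \<longrightarrow> card (components (edge_induced_subgraph G C)) \<le> 2)"

text \<open>Graphs being finite, it is no restriction to take natural numbers as vertices.\<close>

definition quasi_graphic :: "'a set_system \<Rightarrow> bool" where
  "quasi_graphic M \<longleftrightarrow> matroid M \<and> (\<exists>G :: (nat, 'a) pre_multigraph. framework M G)"

end

theory Submission
  imports Defs
begin

text \<open>An excluded minor \<open>M\<close> of positive rank \<open>r\<close> is simple, and in a framework of a simple matroid of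
  rank at most \<open>r\<close> with many elements, some two vertices \<open>u\<close>, \<open>v\<close> are joined by many edges; these
  have rank 2. So if \<open>M\<close> has many elements, then it has a long line, and after deleting a suitable
  element \<open>e\<close> of this line there is a framework of \<open>M \ e\<close> in which many elements of the line join
  \<open>u\<close> and \<open>v\<close>. Adding \<open>e\<close> to this framework, either as an edge \<open>uv\<close> or as a loop at \<open>u\<close> or \<open>v\<close>,
  gives a framework of \<open>M\<close>: in a circuit through \<open>e\<close> one may replace \<open>e\<close> by one or two generic
  elements of the line. So the number of elements of \<open>M\<close> is bounded in terms of \<open>r\<close>.\<close>

section \<open>Rank, closure and circuits\<close>

text \<open>The closure condition dictates how \<open>e\<close> re-enters: if \<open>e\<close> is
  spanned by the edges avoiding \<open>u\<close>, it may not become a non-loop at \<open>u\<close>.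
  The obstacle is the resulting loop. An edge \<open>uv\<close> keeps the connectivity that the
  substituted line elements provide, but a loop at \<open>v\<close> does not join \<open>u\<close>
  to \<open>v\<close>, so a circuit through \<open>e\<close> might fall into three components. A
  count of edges against vertices excludes this: the rank bound on components limits ranks from
  above, while the closure condition makes each vertex of a suitable set cost one in rank.

  The pigeonhole argument is needed twice. The element deleted to find the line need not lie on it;
  and once an element of the line is deleted, the new framework may be unrelated to the old one, so
  a parallel class has to be found again, now inside the line. The powers of 4 arise because all
  ends of non-loops are among the at most 2r ends of a basis. Deletions are the only minors that are
  used.\<close>

context matroid
begin

lemma rank_of_mono: "X \<subseteq> Y \<Longrightarrow> rank_of M X \<le> rank_of M Y"
  using rank_of_witness[of X] card_le_rank_of by (metis subset_trans)

lemma rank_of_indep: "I \<in> indeps M \<Longrightarrow> rank_of M I = card I"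
  using rank_of_witness[of I] card_le_rank_of[of I I]
  by (metis card_mono finite_indep order_antisym order_refl)

lemma rank_of_le_insert: "rank_of M X \<le> rank_of M (insert e X)"
  by (rule rank_of_mono) auto

lemma indep_if_rank_of: "finite X \<Longrightarrow> rank_of M X = card X \<Longrightarrow> X \<in> indeps M"
  using rank_of_witness[of X] by (metis card_seteq order_refl)

lemma rank_of_insert_eq_iff:
  assumes B: "B \<in> indeps M" "B \<subseteq> X" "card B = rank_of M X"
  shows "rank_of M (insert e X) = rank_of M X \<longleftrightarrow> e \<in> B \<or> insert e B \<notin> indeps M"
proof
  assume eq: "rank_of M (insert e X) = rank_of M X"
  show "e \<in> B \<or> insert e B \<notin> indeps M"
  proof (rule ccontr)
    assume "\<not> ?thesis"
    then have "insert e B \<in> indeps M" "e \<notin> B" by auto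
    then show False
      using card_le_rank_of[of "insert e B" "insert e X"] B eq finite_indep[OF B(1)] by auto
  qed
next
  assume e: "e \<in> B \<or> insert e B \<notin> indeps M"
  obtain A where A: "A \<in> indeps M" "B \<subseteq> A" "A \<subseteq> insert e X" "card A = rank_of M (insert e X)"
    using extend_indep[OF B(1), of "insert e X"] B(2) by auto
  have "A \<subseteq> X"
  proof (cases "e \<in> B")
    case False
    with e have "insert e B \<notin> indeps M" by simp
    then have "e \<notin> A" using A subset_indep[OF A(1), of "insert e B"] by auto
    with A show ?thesis by auto
  qed (use A B in auto)
  then have "rank_of M (insert e X) \<le> rank_of M X" using A card_le_rank_of by metis
  then show "rank_of M (insert e X) = rank_of M X"
    using rank_of_le_insert[of X e] by auto
qed

text \<open>This weak form of submodularity carries the whole closure calculus. A basis of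
  \<open>X\<close> extends to a basis of \<open>Y\<close>, and a dependence of \<open>e\<close> on
  the smaller basis persists in the larger one.\<close>

lemma rank_of_insert_eq_mono:
  assumes "rank_of M (insert e X) = rank_of M X" "X \<subseteq> Y"
  shows "rank_of M (insert e Y) = rank_of M Y"
proof -
  obtain B where B: "B \<in> indeps M" "B \<subseteq> X" "card B = rank_of M X"
    using rank_of_witness by blast
  obtain A where A: "A \<in> indeps M" "B \<subseteq> A" "A \<subseteq> Y" "card A = rank_of M Y"
    using extend_indep[OF B(1), of Y] B(2) assms(2) by auto
  have "e \<in> B \<or> insert e B \<notin> indeps M" using rank_of_insert_eq_iff[OF B] assms(1) by simp
  then have "e \<in> A \<or> insert e A \<notin> indeps M"
    using A(2) subset_indep[of "insert e A" "insert e B"] by auto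
  then show ?thesis using rank_of_insert_eq_iff[OF A(1,3,4)] by simp
qed

lemma rank_of_insert_le: "rank_of M (insert e X) \<le> Suc (rank_of M X)"
proof -
  obtain B where B: "B \<in> indeps M" "B \<subseteq> insert e X" "card B = rank_of M (insert e X)"
    using rank_of_witness by blast
  have "card (B - {e}) \<le> rank_of M X"
    using B subset_indep[OF B(1)] by (intro card_le_rank_of) auto
  moreover have "card B \<le> Suc (card (B - {e}))"
    using finite_indep[OF B(1)] by (cases "e \<in> B") (simp_all add: card_Suc_Diff1)
  ultimately show ?thesis using B by simp
qed

lemma in_closure_of: "e \<in> closure_of M X \<longleftrightarrow> e \<in> ground M \<and> rank_of M (insert e X) = rank_of M X"
  by (simp add: closure_of_def)

lemma closure_of_mono: "X \<subseteq> Y \<Longrightarrow> closure_of M X \<subseteq> closure_of M Y"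
  using rank_of_insert_eq_mono by (auto simp: in_closure_of)

lemma closure_of_extensive: "X \<subseteq> ground M \<Longrightarrow> X \<subseteq> closure_of M X"
  by (auto simp: in_closure_of insert_absorb)

lemma rank_of_Un_closure:
  assumes "Y \<subseteq> closure_of M X"
  shows "rank_of M (X \<union> Y) = rank_of M X"
proof -
  have "finite Y" by (rule finite_subset[OF _ finite_ground]) (use assms in \<open>auto simp: in_closure_of\<close>)
  then show ?thesis using assms
  proof (induction Y)
    case (insert y Y)
    then have "rank_of M (insert y X) = rank_of M X" by (simp add: in_closure_of)
    then have "rank_of M (insert y (X \<union> Y)) = rank_of M (X \<union> Y)"
      by (rule rank_of_insert_eq_mono) simp
    with insert show ?case by simp
  qed simp
qed

lemma closure_of_subset_closure:
  assumes "Y \<subseteq> closure_of M X"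
  shows "closure_of M Y \<subseteq> closure_of M X"
proof
  fix e assume "e \<in> closure_of M Y"
  then have e: "e \<in> ground M" "rank_of M (insert e Y) = rank_of M Y" by (auto simp: in_closure_of)
  have "rank_of M (insert e (X \<union> Y)) = rank_of M (X \<union> Y)"
    by (rule rank_of_insert_eq_mono[OF e(2)]) simp
  then have "rank_of M (insert e X) \<le> rank_of M X"
    using rank_of_Un_closure[OF assms] rank_of_mono[of "insert e X" "insert e (X \<union> Y)"] by auto
  then show "e \<in> closure_of M X"
    using e rank_of_le_insert[of X e] by (auto simp: in_closure_of)
qed

lemma closure_of_exchange:
  assumes "f \<in> closure_of M (insert e X)" "f \<notin> closure_of M X" "e \<in> ground M"
  shows "e \<in> closure_of M (insert f X)"
proof -
  have "rank_of M (insert f X) = Suc (rank_of M X)"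
    using assms rank_of_insert_le[of f X] rank_of_le_insert[of X f]
    by (auto simp: in_closure_of)
  moreover have "rank_of M (insert f (insert e X)) \<le> Suc (rank_of M X)"
    using assms rank_of_insert_le[of e X] by (auto simp: in_closure_of)
  ultimately show ?thesis
    using assms rank_of_le_insert[of "insert f X" e]
    by (auto simp: in_closure_of insert_commute)
qed

lemma indep_insert_iff:
  assumes "I \<in> indeps M" "e \<in> ground M" "e \<notin> I"
  shows "insert e I \<in> indeps M \<longleftrightarrow> e \<notin> closure_of M I"
  using rank_of_insert_eq_iff[OF assms(1) order_refl] rank_of_indep[OF assms(1)] assms
  by (auto simp: in_closure_of)

lemma circuit_indep: "circuit M C \<Longrightarrow> D \<subset> C \<Longrightarrow> D \<in> indeps M"
  by (auto simp: circuit_def)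

lemma circuit_finite: "circuit M C \<Longrightarrow> finite C"
  using finite_ground finite_subset by (auto simp: circuit_def)

lemma circuit_in_closure: "circuit M C \<Longrightarrow> e \<in> C \<Longrightarrow> e \<in> closure_of M (C - {e})"
proof -
  assume C: "circuit M C" "e \<in> C"
  then have "C - {e} \<in> indeps M" by (intro circuit_indep) auto
  with C show ?thesis
    using indep_insert_iff[of "C - {e}" e] by (auto simp: circuit_def insert_absorb)
qed

lemma circuit_not_in_closure:
  assumes "circuit M C" "e \<in> C" "b \<in> C" "b \<noteq> e"
  shows "e \<notin> closure_of M (C - {e} - {b})"
proof -
  have "insert e (C - {e} - {b}) = C - {b}" using assms by auto
  moreover have "C - {b} \<in> indeps M" "C - {e} - {b} \<in> indeps M"
    using assms by (auto intro: circuit_indep)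
  ultimately show ?thesis
    using indep_insert_iff[of "C - {e} - {b}" e] assms by (auto simp: circuit_def)
qed

lemma rank_of_circuit:
  assumes "circuit M C"
  shows "Suc (rank_of M C) = card C"
proof -
  have "C \<noteq> {}" using assms empty_indep by (auto simp: circuit_def)
  then obtain e where e: "e \<in> C" by auto
  then have "C - {e} \<in> indeps M" using assms by (auto intro: circuit_indep)
  then have "rank_of M (C - {e}) = card (C - {e})" by (rule rank_of_indep)
  moreover have "insert e (C - {e}) = C" using e by auto
  then have "rank_of M C = rank_of M (C - {e})"
    using circuit_in_closure[OF assms e] by (simp add: in_closure_of)
  ultimately show ?thesis
    using card_Suc_Diff1[OF circuit_finite[OF assms] e] by simp
qed

lemma dependent_contains_circuit:
  assumes "X \<subseteq> ground M" "X \<notin> indeps M"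
  shows "\<exists>C\<subseteq>X. circuit M C"
proof -
  have "finite X" using assms finite_ground finite_subset by blast
  then show ?thesis using assms
  proof (induction X rule: finite_psubset_induct)
    case (psubset X)
    show ?case
    proof (cases "circuit M X")
      case False
      then obtain D where "D \<subset> X" "D \<notin> indeps M" using psubset by (auto simp: circuit_def)
      then show ?thesis using psubset.IH[of D] psubset.prems by blast
    qed auto
  qed
qed

lemma circuitI:
  assumes "C \<subseteq> ground M" "C \<notin> indeps M" "\<And>e. e \<in> C \<Longrightarrow> C - {e} \<in> indeps M"
  shows "circuit M C"
  unfolding circuit_def
proof (intro conjI assms allI impI)
  fix D assume "D \<subset> C"
  then obtain e where "e \<in> C" "D \<subseteq> C - {e}" by auto
  then show "D \<in> indeps M" using assms(3) subset_indep by blast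
qed

text \<open>Since \<open>f\<close> depends on \<open>B\<close> but on no \<open>B - {b}\<close>,
  removing any single element of \<open>insert f B\<close> leaves an independent set. Replacing an
  element of a circuit goes through this criterion.\<close>

lemma circuit_insertI:
  assumes "B \<in> indeps M" "f \<in> closure_of M B" "\<And>b. b \<in> B \<Longrightarrow> f \<notin> closure_of M (B - {b})" "f \<notin> B"
  shows "circuit M (insert f B)"
proof (rule circuitI)
  have f: "f \<in> ground M" using assms by (simp add: in_closure_of)
  then show "insert f B \<subseteq> ground M" using assms indeps_subset by auto
  show "insert f B \<notin> indeps M" using assms f indep_insert_iff by blast
  fix e assume e: "e \<in> insert f B"
  show "insert f B - {e} \<in> indeps M"
  proof (cases "e = f")
    case False
    then have "insert f B - {e} = insert f (B - {e})" by auto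
    moreover have "insert f (B - {e}) \<in> indeps M"
      using e False assms f subset_indep[OF assms(1)] by (subst indep_insert_iff) auto
    ultimately show ?thesis by simp
  qed (use assms in auto)
qed

lemma rank_of_delete: "X \<inter> D = {} \<Longrightarrow> rank_of (delete M D) X = rank_of M X"
proof -
  assume "X \<inter> D = {}"
  then have "{I \<in> indeps (delete M D). I \<subseteq> X} = {I \<in> indeps M. I \<subseteq> X}"
    by (auto simp: delete_def dest: indeps_subset)
  then show ?thesis by (simp add: rank_of_def)
qed

lemma circuit_delete: "circuit (delete M D) C \<longleftrightarrow> circuit M C \<and> C \<inter> D = {}"
  by (auto simp: circuit_def delete_def) 

lemma closure_of_delete: "X \<inter> D = {} \<Longrightarrow> closure_of (delete M D) X = closure_of M X - D"
  using rank_of_delete[of X D] rank_of_delete[of "insert _ X" D]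
  by (auto simp: closure_of_def delete_def)

text \<open>Minors are deletions from a contraction, so even a plain deletion needs this
  equation.\<close>

lemma contract_empty: "contract M {} = M"
proof -
  have "{I. I \<subseteq> ground M \<and> rank_of M I = card I} = indeps M"
    using indep_if_rank_of rank_of_indep indeps_subset finite_subset[OF _ finite_ground] by blast
  moreover have "rank_of M {} = 0" using rank_of_indep[OF empty_indep] by simp
  ultimately show ?thesis by (simp add: contract_def)
qed

lemma proper_minor_delete:
  assumes "e \<in> ground M"
  shows "proper_minor (delete M {e}) M"
proof -
  have "ground (delete M {e}) \<noteq> ground M" using assms by (auto simp: delete_def)
  then have "delete M {e} \<noteq> M" by auto
  moreover have "minor (delete M {e}) M"
    unfolding minor_def using assms contract_empty by (metis empty_subsetI inf_bot_left singletonD subsetI)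
  ultimately show ?thesis by (simp add: proper_minor_def)
qed

end

section \<open>Connectivity and cuts in frameworks\<close>

text \<open>End map and edge set are separate arguments: connectivity is needed for circuits and
  parts of circuits, and for an end map changed at one edge, without building a graph each
  time.\<close>

definition adj :: "('e \<Rightarrow> 'v set) \<Rightarrow> 'e set \<Rightarrow> ('v \<times> 'v) set" where
  "adj n F = {(x, y). \<exists>e\<in>F. n e = {x, y}}"

lemma adj_cong: "(\<And>f. f \<in> F \<Longrightarrow> n f = n' f) \<Longrightarrow> adj n F = adj n' F"
  by (auto simp: adj_def)

lemma adj_Un: "adj n (F \<union> F') = adj n F \<union> adj n F'"
  by (auto simp: adj_def)

abbreviation conn :: "('e \<Rightarrow> 'v set) \<Rightarrow> 'e set \<Rightarrow> ('v \<times> 'v) set" where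
  "conn n F \<equiv> (adj n F)\<^sup>*"

lemma adjacency_eq_adj: "adjacency G = adj (ends G) (edges G)"
  by (simp add: adjacency_def adj_def)

lemma sym_conn: "sym (conn n F)"
  by (rule sym_rtrancl) (auto simp: sym_def adj_def insert_commute)

lemma conn_sym: "(x, y) \<in> conn n F \<Longrightarrow> (y, x) \<in> conn n F"
  using sym_conn by (metis symD)

lemma equiv_conn: "equiv UNIV (conn n F)"
  by (intro equivI sym_conn trans_rtrancl) (auto simp: refl_on_def)

lemma conn_mono: "F \<subseteq> F' \<Longrightarrow> conn n F \<subseteq> conn n F'"
  by (rule rtrancl_mono) (auto simp: adj_def)

lemma conn_edge: "e \<in> F \<Longrightarrow> n e = {x, y} \<Longrightarrow> (x, y) \<in> conn n F"
  by (rule r_into_rtrancl) (auto simp: adj_def)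

lemma conn_closed:
  assumes "(x, y) \<in> conn n F" "x \<in> A" "\<And>e. e \<in> F \<Longrightarrow> n e \<inter> A \<noteq> {} \<Longrightarrow> n e \<subseteq> A"
  shows "y \<in> A"
  using assms(1)
proof induction
  case (step y z)
  then obtain e where "e \<in> F" "n e = {y, z}" by (auto simp: adj_def)
  with step.IH assms(3)[of e] show ?case by auto
qed (fact assms(2))

lemma conn_crossing_edge:
  assumes "(x, y) \<in> conn n F" "x \<in> U" "y \<notin> U"
  shows "\<exists>e\<in>F. \<exists>a\<in>U. \<exists>b. b \<notin> U \<and> n e = {a, b}"
  using assms
proof (induction rule: converse_rtrancl_induct)
  case (step x z)
  then obtain e where "e \<in> F" "n e = {x, z}" by (auto simp: adj_def)
  with step show ?case by (cases "z \<in> U") auto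
qed simp

text \<open>Having at most two components becomes a statement about three vertices, which transfers
  between edge sets without counting classes.\<close>

lemma card_quotient_le_2_iff:
  assumes V: "finite V" and R: "equiv UNIV R"
  shows "card (V // R) \<le> 2 \<longleftrightarrow>
    (\<forall>x\<in>V. \<forall>y\<in>V. \<forall>z\<in>V. (x, y) \<in> R \<or> (x, z) \<in> R \<or> (y, z) \<in> R)"
proof -
  have fin: "finite (V // R)" using V by (simp add: quotient_def)
  have eq: "R `` {x} = R `` {y} \<longleftrightarrow> (x, y) \<in> R" for x y
    using eq_equiv_class_iff[OF R] by simp
  show ?thesis
  proof (intro iffI ballI)
    fix x y z assume 2: "card (V // R) \<le> 2" and xyz: "x \<in> V" "y \<in> V" "z \<in> V"
    have "{R `` {x}, R `` {y}, R `` {z}} \<subseteq> V // R" using xyz by (auto simp: quotient_def)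
    then have "card {R `` {x}, R `` {y}, R `` {z}} \<le> 2" 
      by (rule order_trans[OF card_mono[OF fin] 2])
    then have "R `` {x} = R `` {y} \<or> R `` {x} = R `` {z} \<or> R `` {y} = R `` {z}"
      by (auto simp: card_insert_if split: if_splits)
    then show "(x, y) \<in> R \<or> (x, z) \<in> R \<or> (y, z) \<in> R" by (simp add: eq)
  next
    assume 3: "\<forall>x\<in>V. \<forall>y\<in>V. \<forall>z\<in>V. (x, y) \<in> R \<or> (x, z) \<in> R \<or> (y, z) \<in> R"
    show "card (V // R) \<le> 2"
    proof (rule ccontr)
      assume "\<not> ?thesis"
      then have "3 \<le> card (V // R)" by simp
      then obtain T where "T \<subseteq> V // R" "card T = 3" by (rule obtain_subset_with_card_n)
      then obtain X Y Z where XYZ: "X \<in> V // R" "Y \<in> V // R" "Z \<in> V // R"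
          "X \<noteq> Y" "X \<noteq> Z" "Y \<noteq> Z"
        by (auto simp: card_3_iff)
      then obtain x y z where "x \<in> V" "y \<in> V" "z \<in> V" "X = R `` {x}" "Y = R `` {y}" "Z = R `` {z}"
        by (metis quotientE)
      then show False using 3 XYZ(4-6) eq by metis
    qed
  qed
qed

lemma card_components: "card (components G) = card (verts G // (adjacency G)\<^sup>*)"
  unfolding components_def
  by (intro card_image inj_onI) (auto simp: induced_subgraph_def)

lemma components_edge_induced_le_2_iff:
  assumes "finite (\<Union>e\<in>C. ends G e)"
  shows "card (components (edge_induced_subgraph G C)) \<le> 2 \<longleftrightarrow>
    (\<forall>x\<in>\<Union>e\<in>C. ends G e. \<forall>y\<in>\<Union>e\<in>C. ends G e. \<forall>z\<in>\<Union>e\<in>C. ends G e.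
      (x, y) \<in> conn (ends G) C \<or> (x, z) \<in> conn (ends G) C \<or> (y, z) \<in> conn (ends G) C)"
proof -
  have "verts (edge_induced_subgraph G C) = (\<Union>e\<in>C. ends G e)"
    "adjacency (edge_induced_subgraph G C) = adj (ends G) C"
    by (simp_all add: adjacency_eq_adj edge_induced_subgraph_def)
  then show ?thesis
    using card_quotient_le_2_iff[OF assms equiv_conn, of "ends G" C]
    unfolding card_components by simp
qed

lemma framework_iff:
  "framework M G \<longleftrightarrow> multigraph G \<and> edges G = ground M \<and>
     (\<forall>x\<in>verts G. rank_of M {e \<in> ground M. ends G e \<subseteq> conn (ends G) (ground M) `` {x}}
        \<le> card (conn (ends G) (ground M) `` {x})) \<and>
     (\<forall>v\<in>verts G. \<forall>e\<in>closure_of M {f \<in> ground M. v \<notin> ends G f}. v \<in> ends G e \<longrightarrow> ends G e = {v}) \<and>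
     (\<forall>C. circuit M C \<longrightarrow> (\<forall>x\<in>\<Union>e\<in>C. ends G e. \<forall>y\<in>\<Union>e\<in>C. ends G e. \<forall>z\<in>\<Union>e\<in>C. ends G e.
        (x, y) \<in> conn (ends G) C \<or> (x, z) \<in> conn (ends G) C \<or> (y, z) \<in> conn (ends G) C))"
  (is "_ \<longleftrightarrow> _ \<and> _ \<and> ?rank \<and> ?star \<and> ?circ")
proof (cases "multigraph G \<and> edges G = ground M")
  case True
  then interpret multigraph G by simp
  have E: "edges G = ground M" using True by simp
  have "components G = (\<lambda>x. induced_subgraph G (conn (ends G) (ground M) `` {x})) ` verts G"
    by (auto simp: components_def quotient_def adjacency_eq_adj E)
  then have "(\<forall>H\<in>components G. rank_of M (edges H) \<le> card (verts H)) \<longleftrightarrow> ?rank"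
    by (simp add: induced_subgraph_def E)
  moreover have "edges (delete_vertex G v) = {f \<in> ground M. v \<notin> ends G f}" for v
    using ends_subset by (auto simp: delete_vertex_def induced_subgraph_def E)
  then have "closure_of M (edges (delete_vertex G v)) \<subseteq> edges (delete_vertex G v) \<union> loops_at G v
      \<longleftrightarrow> (\<forall>e\<in>closure_of M {f \<in> ground M. v \<notin> ends G f}. v \<in> ends G e \<longrightarrow> ends G e = {v})" for v
    unfolding subset_iff loops_at_def E by (simp add: closure_of_def)
  then have "(\<forall>v\<in>verts G. closure_of M (edges (delete_vertex G v))
        \<subseteq> edges (delete_vertex G v) \<union> loops_at G v) \<longleftrightarrow> ?star"
    by simp
  moreover have "finite (\<Union>e\<in>C. ends G e)" if "circuit M C" for C
    using that ends_subset E by (intro finite_subset[OF _ finite_verts]) (auto simp: circuit_def)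
  then have "(\<forall>C. circuit M C \<longrightarrow> card (components (edge_induced_subgraph G C)) \<le> 2) \<longleftrightarrow> ?circ"
    using components_edge_induced_le_2_iff[of G] by auto
  ultimately show ?thesis using True unfolding framework_def by simp
next
  case False
  moreover from this have "\<not> framework M G" unfolding framework_def by blast
  ultimately show ?thesis by blast
qed

section \<open>Rank bounds from vertex cuts in a framework\<close>

locale framed_matroid = matroid M for M :: "'a set_system" +
  fixes G :: "('v, 'a) pre_multigraph"
  assumes framework: "framework M G"
begin

sublocale multigraph G
  using framework by (simp add: framework_def)

abbreviation "n \<equiv> ends G"

lemma edges_eq: "edges G = ground M"
  using framework by (simp add: framework_def)

lemma ends_subset_verts: "e \<in> ground M \<Longrightarrow> n e \<subseteq> verts G"
  using ends_subset edges_eq by auto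

lemma ends_cases:
  assumes "e \<in> ground M"
  obtains x y where "n e = {x, y}"
  using card_ends[of e] assms edges_eq by (auto simp: card_1_singleton_iff card_2_iff)

lemma star_loop:
  assumes "v \<in> verts G" "e \<in> closure_of M {f \<in> ground M. v \<notin> n f}" "v \<in> n e"
  shows "n e = {v}"
proof -
  have "\<forall>v\<in>verts G. \<forall>e\<in>closure_of M {f \<in> ground M. v \<notin> n f}. v \<in> n e \<longrightarrow> n e = {v}"
    using framework unfolding framework_iff by (elim conjE)
  with assms show ?thesis by simp
qed

text \<open>The closure condition enters rank arguments in this form: \<open>X\<close> consists of
  edges avoiding \<open>w\<close>, and their closure contains no edge at \<open>w\<close> except
  loops.\<close>

lemma not_in_closure_star:
  assumes "e \<in> ground M" "n e = {w, z}" "w \<noteq> z" "X \<subseteq> ground M" "\<And>x. x \<in> X \<Longrightarrow> w \<notin> n x"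
  shows "e \<notin> closure_of M X"
proof
  assume "e \<in> closure_of M X"
  moreover have "closure_of M X \<subseteq> closure_of M {f \<in> ground M. w \<notin> n f}"
    using assms(4,5) by (intro closure_of_mono) auto
  moreover have "w \<in> verts G" using ends_subset_verts[OF assms(1)] assms(2) by auto
  ultimately have "n e = {w}" using assms(2) star_loop[of w e] by auto
  with assms(2,3) show False by auto
qed

lemma circuit_conn:
  assumes "circuit M C" "x \<in> (\<Union>e\<in>C. n e)" "y \<in> (\<Union>e\<in>C. n e)" "z \<in> (\<Union>e\<in>C. n e)"
  shows "(x, y) \<in> conn n C \<or> (x, z) \<in> conn n C \<or> (y, z) \<in> conn n C"
proof -
  have "\<forall>C. circuit M C \<longrightarrow> (\<forall>x\<in>\<Union>e\<in>C. n e. \<forall>y\<in>\<Union>e\<in>C. n e. \<forall>z\<in>\<Union>e\<in>C. n e.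
      (x, y) \<in> conn n C \<or> (x, z) \<in> conn n C \<or> (y, z) \<in> conn n C)"
    using framework unfolding framework_iff by (elim conjE)
  with assms show ?thesis by blast
qed

lemma conn_subset_verts:
  assumes "x \<in> verts G" "F \<subseteq> ground M"
  shows "conn n F `` {x} \<subseteq> verts G"
proof
  fix y assume "y \<in> conn n F `` {x}"
  then have "(x, y) \<in> conn n F" by simp
  then show "y \<in> verts G"
    by (rule conn_closed[where A = "verts G"]) (use assms ends_subset_verts in auto)
qed

lemma ends_subset_conn_class:
  assumes "F \<subseteq> ground M" "e \<in> F" "n e \<inter> conn n F `` {x} \<noteq> {}"
  shows "n e \<subseteq> conn n F `` {x}"
proof -
  obtain a b where ab: "n e = {a, b}" using ends_cases assms by blast
  then have "(a, b) \<in> conn n F" "(b, a) \<in> conn n F"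
    using conn_edge[OF assms(2), of n a b] conn_edge[OF assms(2), of n b a]
    by (simp_all add: insert_commute)
  then show ?thesis using assms(3) ab by (auto intro: rtrancl_trans)
qed

text \<open>Each vertex of \<open>U\<close> costs one in rank. An edge leaving \<open>U\<close> at
  \<open>a\<close> is not spanned by the edges avoiding \<open>U\<close>, yet it avoids
  \<open>U - {a}\<close>; so returning \<open>a\<close> to the allowed vertices raises the rank, and
  induction removes the other vertices.\<close>

lemma rank_of_cut:
  assumes "finite U" "S \<subseteq> ground M"
    and "\<And>U'. U' \<subseteq> U \<Longrightarrow> U' \<noteq> {} \<Longrightarrow> \<exists>e\<in>S. \<exists>a\<in>U'. \<exists>b. b \<notin> U' \<and> n e = {a, b}"
  shows "rank_of M {e \<in> S. n e \<inter> U = {}} + card U \<le> rank_of M S"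
  using assms(1,3)
proof (induction U rule: finite_psubset_induct)
  case (psubset U)
  show ?case
  proof (cases "U = {}")
    case False
    then obtain e a b where e: "e \<in> S" "a \<in> U" "b \<notin> U" "n e = {a, b}"
      using psubset.prems[of U] by blast
    let ?A = "\<lambda>U. {e \<in> S. n e \<inter> U = {}}"
    have "rank_of M (?A (U - {a})) + card (U - {a}) \<le> rank_of M S"
      using e(2) psubset.prems by (intro psubset.IH) (auto simp: subset_Diff_insert)
    moreover have "e \<notin> closure_of M (?A U)"
      using e assms(2) by (intro not_in_closure_star[of e a b]) auto
    then have "Suc (rank_of M (?A U)) \<le> rank_of M (insert e (?A U))"
      using e(1) assms(2) rank_of_le_insert[of "?A U" e] by (auto simp: in_closure_of)
    moreover have "rank_of M (insert e (?A U)) \<le> rank_of M (?A (U - {a}))"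
      using e by (intro rank_of_mono) auto
    ultimately show ?thesis using card_Suc_Diff1[OF psubset.hyps e(2)] by linarith
  qed simp
qed

text \<open>A framework bounds the rank of whole components only. The vertices of the component
  outside \<open>W\<close> are peeled off by \<open>rank_of_cut\<close>: every nonempty set of them
  has an edge leaving it on a path to \<open>x\<close>.\<close>

lemma rank_of_span_le:
  assumes "x \<in> W" "W \<subseteq> conn n (ground M) `` {x}" "x \<in> verts G"
  shows "rank_of M {e \<in> ground M. n e \<subseteq> W} \<le> card W"
proof -
  let ?H = "conn n (ground M) `` {x}"
  let ?S = "{e \<in> ground M. n e \<subseteq> ?H}"
  have H: "finite ?H" 
    by (rule finite_subset[OF conn_subset_verts[OF assms(3) order_refl] finite_verts])
  have "rank_of M {e \<in> ?S. n e \<inter> (?H - W) = {}} + card (?H - W) \<le> rank_of M ?S"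
  proof (rule rank_of_cut)
    fix U assume U: "U \<subseteq> ?H - W" "U \<noteq> {}"
    then obtain u where u: "u \<in> U" "(u, x) \<in> conn n (ground M)" "x \<notin> U"
      using assms(1) conn_sym by fastforce
    then obtain e a b where "e \<in> ground M" "a \<in> U" "b \<notin> U" "n e = {a, b}"
      using conn_crossing_edge[OF u(2,1,3)] by blast
    moreover from this have "n e \<subseteq> ?H"
      using U by (intro ends_subset_conn_class) auto
    ultimately show "\<exists>e\<in>?S. \<exists>a\<in>U. \<exists>b. b \<notin> U \<and> n e = {a, b}" by blast
  qed (use H in auto)
  moreover have "{e \<in> ?S. n e \<inter> (?H - W) = {}} = {e \<in> ground M. n e \<subseteq> W}"
    using assms(2) by auto
  moreover have "rank_of M ?S \<le> card ?H"
    using framework assms(3) unfolding framework_iff by (elim conjE) (rule bspec)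
  moreover have "card (?H - W) = card ?H - card W" "card W \<le> card ?H"
    using H assms(2) by (auto intro: card_Diff_subset finite_subset card_mono)
  ultimately show ?thesis by simp
qed

end

section \<open>Parallel classes in frameworks of simple matroids\<close>

text \<open>The case \<open>e = f\<close> excludes loops of the matroid, the case
  \<open>e \<noteq> f\<close> excludes parallel pairs.\<close>

definition simple :: "'a set_system \<Rightarrow> bool" where
  "simple M \<longleftrightarrow> (\<forall>e\<in>ground M. \<forall>f\<in>ground M. {e, f} \<in> indeps M)"

context matroid
begin

lemma circuit_card_ge_3:
  assumes "simple M" "circuit M C"
  shows "3 \<le> card C"
proof (rule ccontr)
  assume "\<not> ?thesis"
  moreover have "C \<noteq> {}" "finite C"
    using assms(2) empty_indep circuit_finite by (auto simp: circuit_def)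
  then have "card C \<noteq> 0" by simp
  ultimately have "card C = 1 \<or> card C = 2" by linarith
  then obtain e f where "C = {e, f}"
    by (auto simp: card_1_singleton_iff card_2_iff)
  with assms show False by (auto simp: simple_def circuit_def)
qed

end

section \<open>Edges against vertices in circuits, loops and parallel classes\<close>

context framed_matroid
begin

text \<open>The edges avoiding \<open>U\<close> form a proper subset of \<open>C\<close>, hence are
  independent, and by \<open>rank_of_cut\<close> there are at most
  \<open>rank_of M C - card U\<close> of them. The strict inequality comes from the rank of a
  circuit being one less than its size.\<close>

lemma circuit_cut:
  assumes C: "circuit M C" and U: "finite U" "U \<noteq> {}"
    and cut: "\<And>U'. U' \<subseteq> U \<Longrightarrow> U' \<noteq> {} \<Longrightarrow> \<exists>e\<in>C. \<exists>a\<in>U'. \<exists>b. b \<notin> U' \<and> n e = {a, b}"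
  shows "card U < card {e \<in> C. n e \<inter> U \<noteq> {}}"
proof -
  let ?Q = "{e \<in> C. n e \<inter> U = {}}"
  have rank: "rank_of M ?Q + card U \<le> rank_of M C"
    using C U(1) cut by (intro rank_of_cut) (auto simp: circuit_def)
  have "card U \<noteq> 0" using U by simp
  with rank have "?Q \<noteq> C" by auto
  then have "?Q \<in> indeps M" by (intro circuit_indep[OF C]) auto
  then have "rank_of M ?Q = card ?Q" by (rule rank_of_indep)
  moreover have "card C = card ?Q + card {e \<in> C. n e \<inter> U \<noteq> {}}"
    using circuit_finite[OF C] by (subst card_Un_disjoint[symmetric]) (auto intro: arg_cong[of _ _ card])
  ultimately show ?thesis using rank rank_of_circuit[OF C] by linarith
qed

text \<open>By \<open>circuit_cut\<close>, the components of \<open>u\<close> and \<open>v\<close> in \<open>B\<close>, together with \<open>D\<close>, have more edges than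
  vertices. Such a connected edge set is dependent, so it is the whole circuit.\<close>

lemma circuit_bridge_class:
  assumes C: "circuit M (B \<union> D)" "B \<inter> D = {}"
    and D: "d \<in> D" "\<And>d. d \<in> D \<Longrightarrow> n d = {u, v}"
    and u: "u \<in> (\<Union>e\<in>B. n e)" and uv: "(u, v) \<notin> conn n B"
    and x: "x \<in> (\<Union>e\<in>B. n e)"
  shows "(u, x) \<in> conn n B \<or> (v, x) \<in> conn n B"
proof -
  let ?W = "\<lambda>w. conn n B `` {w}"
  let ?E = "\<lambda>w. {e \<in> B. n e \<inter> ?W w \<noteq> {}}"
  have B: "B \<subseteq> ground M" and dM: "d \<in> ground M" using C D(1) by (auto simp: circuit_def)
  have fin: "finite B" "finite D" using circuit_finite[OF C(1)] by auto
  have uvV: "u \<in> verts G" "v \<in> verts G" using ends_subset_verts[OF dM] D by auto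
  have finW: "finite (?W w)" if "w \<in> verts G" for w
    using conn_subset_verts[OF that B] finite_verts finite_subset by auto
  have disj: "y \<notin> ?W v" if "y \<in> ?W u" for y
    using that uv conn_sym[of v y n B] rtrancl_trans[of u y _ v] by auto
  have Esub: "n e \<subseteq> ?W w" if "e \<in> ?E w" for e w
    using that B by (intro ends_subset_conn_class) auto
  \<comment> \<open>The cut leaves out \<open>u\<close>, so that no edge of \<open>D\<close> meets
    it and all counted edges lie in \<open>B\<close>. If nothing else is in the class, the
    hypothesis that \<open>B\<close> has an edge at \<open>u\<close> supplies the count.\<close>
  have "card (?W u) \<le> card (?E u)"
  proof (cases "?W u = {u}")
    case True
    obtain e where e: "e \<in> B" "u \<in> n e" using u by auto
    then have "e \<in> ?E u" by auto
    then have "0 < card (?E u)" using fin(1) by (auto simp: card_gt_0_iff)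
    with True show ?thesis by simp
  next
    case False
    let ?U = "?W u - {u}"
    have "card ?U < card {e \<in> B \<union> D. n e \<inter> ?U \<noteq> {}}"
    proof (rule circuit_cut[OF C(1)])
      show "?U \<noteq> {}" using False by auto
      fix U assume U: "U \<subseteq> ?U" "U \<noteq> {}"
      then obtain a where a: "a \<in> U" "(u, a) \<in> conn n B" by auto
      have "u \<notin> U" using U by auto
      from conn_crossing_edge[OF conn_sym[OF a(2)] a(1) this]
      show "\<exists>e\<in>B \<union> D. \<exists>a\<in>U. \<exists>b. b \<notin> U \<and> n e = {a, b}" by blast
    qed (use finW uvV in auto)
    also have "\<dots> \<le> card (?E u)"
      using fin D uv by (intro card_mono) auto
    finally have "Suc (card ?U) \<le> card (?E u)" by (rule Suc_leI)
    then show ?thesis using card_Suc_Diff1[OF finW[OF uvV(1)], of u] by simp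
  qed
  \<comment> \<open>Here the whole class is cut off, with \<open>D\<close> as the way out to
    \<open>u\<close>. Thus \<open>D\<close> is counted on one side only, and the inequality stays
    strict.\<close>
  moreover have "card (?W v) < card (?E v) + card D"
  proof -
    have "card (?W v) < card {e \<in> B \<union> D. n e \<inter> ?W v \<noteq> {}}"
    proof (rule circuit_cut[OF C(1)])
      show "?W v \<noteq> {}" by auto
      fix U assume U: "U \<subseteq> ?W v" "U \<noteq> {}"
      show "\<exists>e\<in>B \<union> D. \<exists>a\<in>U. \<exists>b. b \<notin> U \<and> n e = {a, b}"
      proof (cases "U = ?W v")
        case True
        have "u \<notin> U" "v \<in> U" using True disj[of u] by auto
        moreover have "n d = {v, u}" using D by (simp add: insert_commute)
        ultimately show ?thesis using D(1) by blast
      next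
        case False
        then obtain a b where ab: "a \<in> U" "(v, a) \<in> conn n B" "(v, b) \<in> conn n B" "b \<notin> U" using U by auto
        have "(a, b) \<in> conn n B" using rtrancl_trans[OF conn_sym[OF ab(2)] ab(3)] .
        from conn_crossing_edge[OF this ab(1,4)] show ?thesis by blast
      qed
    qed (use finW uvV in auto)
    also have "\<dots> \<le> card (?E v \<union> D)"
      using fin by (intro card_mono) auto
    also have "\<dots> \<le> card (?E v) + card D" by (rule card_Un_le)
    finally show ?thesis .
  qed
  moreover have "card (?E u \<union> ?E v \<union> D) = card (?E u) + card (?E v) + card D"
  proof -
    have "?E u \<inter> ?E v = {}" using Esub[of _ u] disj by blast
    then have "card (?E u \<union> ?E v) = card (?E u) + card (?E v)" using fin by (intro card_Un_disjoint) auto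
    moreover have "card (?E u \<union> ?E v \<union> D) = card (?E u \<union> ?E v) + card D"
      using fin C(2) by (intro card_Un_disjoint) auto
    ultimately show ?thesis by simp
  qed
  moreover have "card (?W u \<union> ?W v) \<le> card (?W u) + card (?W v)" by (rule card_Un_le)
  ultimately have large: "card (?W u \<union> ?W v) < card (?E u \<union> ?E v \<union> D)" by linarith
  have "?E u \<union> ?E v \<union> D = B \<union> D"
  proof (rule ccontr)
    assume "\<not> ?thesis"
    then have "?E u \<union> ?E v \<union> D \<in> indeps M" by (intro circuit_indep[OF C(1)]) auto
    then have "card (?E u \<union> ?E v \<union> D) \<le> rank_of M {e \<in> ground M. n e \<subseteq> ?W u \<union> ?W v}"
    proof (rule card_le_rank_of)
      show "?E u \<union> ?E v \<union> D \<subseteq> {e \<in> ground M. n e \<subseteq> ?W u \<union> ?W v}"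
      proof
        fix e assume "e \<in> ?E u \<union> ?E v \<union> D"
        then have "e \<in> ?E u \<or> e \<in> ?E v \<or> e \<in> D" by blast
        then have "n e \<subseteq> ?W u \<union> ?W v"
        proof (elim disjE)
          assume "e \<in> D"
          then show ?thesis using D(2) by auto
        qed (use Esub[of e u] Esub[of e v] in auto)
        moreover have "e \<in> ground M"
          using \<open>e \<in> ?E u \<union> ?E v \<union> D\<close> C(1) by (auto simp: circuit_def)
        ultimately show "e \<in> {e \<in> ground M. n e \<subseteq> ?W u \<union> ?W v}" by simp
      qed
    qed
    also have "\<dots> \<le> card (?W u \<union> ?W v)"
    proof (rule rank_of_span_le)
      have "(u, v) \<in> conn n (ground M)" using dM D by (intro conn_edge[of d]) auto
      then show "?W u \<union> ?W v \<subseteq> conn n (ground M) `` {u}"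
        using conn_mono[OF B, of n] by (auto intro: rtrancl_trans)
    qed (use uvV in auto)
    finally show False using large by simp
  qed
  moreover obtain e where e: "e \<in> B" "x \<in> n e" using x by auto
  ultimately have "e \<in> ?E u \<or> e \<in> ?E v" using C(2) by blast
  then show ?thesis using Esub[of e u] Esub[of e v] e(2) by blast
qed

text \<open>The edges at a single vertex with no other end have rank at most 1, so by simplicity
  distinct loops sit at distinct vertices. A circuit made of loops would have at least three
  elements and hence at least three components; so the loops are independent.\<close>

lemma card_loops_le:
  assumes "simple M" "L \<subseteq> ground M" "\<And>e. e \<in> L \<Longrightarrow> card (n e) = 1"
  shows "card L \<le> rank_of M (ground M)"
proof -
  have inj: "e = f" if ef: "e \<in> L" "f \<in> L" "n e = n f" for e f
  proof -
    obtain w where w: "n e = {w}" using assms(3)[OF ef(1)] by (auto simp: card_1_singleton_iff)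
    then have "w \<in> verts G" using ends_subset_verts[of e] ef assms(2) by auto
    then have "rank_of M {e \<in> ground M. n e \<subseteq> {w}} \<le> card {w}"
      by (intro rank_of_span_le[of w]) auto
    moreover have "{e, f} \<in> indeps M" using assms ef by (auto simp: simple_def)
    then have "card {e, f} \<le> rank_of M {e \<in> ground M. n e \<subseteq> {w}}"
      using ef assms(2) w by (intro card_le_rank_of) auto
    ultimately show ?thesis by (auto simp: card_insert_if split: if_splits)
  qed
  have "L \<in> indeps M"
  proof (rule ccontr)
    assume "L \<notin> indeps M"
    then obtain C where C: "C \<subseteq> L" "circuit M C" using dependent_contains_circuit assms(2) by blast
    obtain T where "T \<subseteq> C" "card T = 3"
      using circuit_card_ge_3[OF assms(1) C(2)] by (rule obtain_subset_with_card_n)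
    then obtain e f g where efg: "e \<in> C" "f \<in> C" "g \<in> C" "e \<noteq> f" "e \<noteq> g" "f \<noteq> g"
      by (auto simp: card_3_iff)
    have loop: "\<exists>x. n h = {x}" if "h \<in> C" for h
      using that C assms(3) by (auto simp: card_1_singleton_iff)
    then obtain x y z where xyz: "n e = {x}" "n f = {y}" "n g = {z}" using loop efg by metis
    have "b = a" if "(a, b) \<in> conn n C" for a b
    proof -
      have "n h \<subseteq> {a}" if "h \<in> C" "n h \<inter> {a} \<noteq> {}" for h
      proof -
        obtain w where "n h = {w}" using loop \<open>h \<in> C\<close> by blast
        with that(2) show ?thesis by simp
      qed
      with conn_closed[OF that, of "{a}"] show ?thesis by auto
    qed
    moreover have "x \<noteq> y" "x \<noteq> z" "y \<noteq> z" 
      using inj[of e f] inj[of e g] inj[of f g] efg C(1) xyz by auto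
    moreover have "(x, y) \<in> conn n C \<or> (x, z) \<in> conn n C \<or> (y, z) \<in> conn n C"
      by (rule circuit_conn[OF C(2)]) (use efg xyz in \<open>auto intro!: bexI\<close>)
    ultimately show False by metis
  qed
  then show ?thesis using card_le_rank_of assms(2) by blast
qed

text \<open>A basis \<open>B\<close> spans every edge, so by the closure condition both ends of a
  non-loop are ends of edges in \<open>B\<close>. These are at most \<open>2 * r\<close> vertices,
  where \<open>r\<close> is the rank, and \<open>4 ^ r\<close> crudely bounds the number of pairs by
  that of all subsets. The summand \<open>r\<close> accounts for the loops of the graph.\<close>

lemma exists_large_parallel_class:
  assumes "simple M" "S \<subseteq> ground M"
    and "rank_of M (ground M) + 4 ^ rank_of M (ground M) * k < card S"
  shows "\<exists>u v. u \<noteq> v \<and> k < card {e \<in> S. n e = {u, v}}"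
proof (rule ccontr)
  assume neg: "\<not> ?thesis"
  let ?r = "rank_of M (ground M)"
  obtain B where B: "B \<in> indeps M" "B \<subseteq> ground M" "card B = ?r" using rank_of_witness by blast
  define V where "V = (\<Union>e\<in>B. n e)"
  have finB: "finite B" using finite_indep[OF B(1)] .
  have finS: "finite S" using assms(2) finite_ground finite_subset by blast
  have le2: "card (n e) = 1 \<or> card (n e) = 2" if "e \<in> ground M" for e
    using card_ends[of e] edges_eq that by auto
  have "card V \<le> (\<Sum>e\<in>B. card (n e))" unfolding V_def using finB by (rule card_UN_le)
  also have "\<dots> \<le> (\<Sum>e\<in>B. 2)" using le2 B(2) by (intro sum_mono) force
  finally have cardV: "card V \<le> 2 * ?r" using B(3) by simp
  have finV: "finite V" unfolding V_def
    using B(2) ends_subset_verts by (intro finite_subset[OF _ finite_verts]) auto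
  let ?L = "{e \<in> S. card (n e) = 1}" and ?N = "{e \<in> S. card (n e) = 2}"
  have "n e \<subseteq> V" if e: "e \<in> ?N" for e
  proof
    fix x assume x: "x \<in> n e"
    obtain a b where ab: "n e = {a, b}" "a \<noteq> b" using e by (auto simp: card_2_iff)
    then obtain y where y: "n e = {x, y}" "x \<noteq> y" using x by (metis insertE insert_commute singletonD)
    have eM: "e \<in> ground M" using e assms(2) by auto
    have "rank_of M (insert e B) = rank_of M B"
      using rank_of_mono[of "insert e B" "ground M"] rank_of_le_insert[of B e] rank_of_indep[OF B(1)] B eM by simp
    then have "e \<in> closure_of M B" using eM by (simp add: in_closure_of)
    then show "x \<in> V" using not_in_closure_star[OF eM y B(2)] by (auto simp: V_def)
  qed
  then have "?N \<subseteq> (\<Union>P\<in>{P \<in> Pow V. card P = 2}. {e \<in> S. n e = P})" by auto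
  then have "card ?N \<le> card (\<Union>P\<in>{P \<in> Pow V. card P = 2}. {e \<in> S. n e = P})"
    using finS finV by (intro card_mono) auto
  also have "\<dots> \<le> (\<Sum>P\<in>{P \<in> Pow V. card P = 2}. card {e \<in> S. n e = P})"
    using finV by (intro card_UN_le) auto
  also have "\<dots> \<le> (\<Sum>P\<in>{P \<in> Pow V. card P = 2}. k)"
    using neg by (intro sum_mono) (auto simp: card_2_iff not_less)
  also have "\<dots> \<le> card (Pow V) * k"
    using finV by (auto intro!: mult_right_mono card_mono)
  also have "\<dots> \<le> 4 ^ ?r * k"
    using cardV finV power_increasing[of "card V" "2 * ?r" "2::nat"]
    by (simp add: card_Pow power_mult)
  finally have "card ?N \<le> 4 ^ ?r * k" .
  moreover have "card ?L \<le> ?r" using assms(1,2) by (intro card_loops_le) auto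
  moreover have "card S \<le> card ?L + card ?N"
  proof -
    have "S = ?L \<union> ?N" using le2 assms(2) by auto
    then show ?thesis using card_Un_le[of ?L ?N] by simp
  qed
  ultimately show False using assms(3) by linarith
qed

lemma rank_of_parallel_class_le: "u \<noteq> v \<Longrightarrow> rank_of M {e \<in> ground M. n e = {u, v}} \<le> 2"
proof (cases "\<exists>e\<in>ground M. n e = {u, v}")
  case True
  assume "u \<noteq> v"
  obtain e where e: "e \<in> ground M" "n e = {u, v}" using True by blast
  have "rank_of M {e \<in> ground M. n e = {u, v}} \<le> rank_of M {e \<in> ground M. n e \<subseteq> {u, v}}"
    by (intro rank_of_mono) auto
  also have "\<dots> \<le> card {u, v}"
    using conn_edge[of e "ground M" n u v] e ends_subset_verts[of e]
    by (intro rank_of_span_le[of u]) auto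
  finally show ?thesis using \<open>u \<noteq> v\<close> by simp
next
  case False
  then have empty: "{e \<in> ground M. n e = {u, v}} = {}" by auto
  show ?thesis unfolding empty using rank_of_indep[OF empty_indep] by simp
qed

end

section \<open>Adding an element to a framework\<close>

definition add_edge :: "('v, 'e) pre_multigraph \<Rightarrow> 'e \<Rightarrow> 'v set \<Rightarrow> ('v, 'e) pre_multigraph" where
  "add_edge G e Z = \<lparr>verts = verts G, edges = insert e (edges G), ends = (ends G)(e := Z)\<rparr>"

context matroid
begin

lemma framed_matroid_delete: "framework (delete M {e}) G \<Longrightarrow> framed_matroid (delete M {e}) G"
  by (simp add: framed_matroid_def framed_matroid_axioms_def matroid_delete)

text \<open>The hypotheses isolate what depends on the new edge. By \<open>conn_Z\<close> the
  components stay the same, and by \<open>span\<close> their rank does not grow. By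
  \<open>star_notin\<close>, adding \<open>e\<close> to the edges avoiding \<open>w\<close> does not
  enlarge their closure, while \<open>star_in\<close> is the closure condition for \<open>e\<close>
  itself. Circuits missing \<open>e\<close> are circuits of the deletion, so \<open>circ\<close>
  treats only the others.\<close>

lemma framework_add_edge:
  assumes e: "e \<in> ground M" and fw: "framework (delete M {e}) G"
    and Z: "Z \<subseteq> verts G" "card Z \<in> {1, 2}"
    and conn_Z: "\<And>x y. x \<in> Z \<Longrightarrow> y \<in> Z \<Longrightarrow> (x, y) \<in> conn (ends G) (ground M - {e})"
    and span: "\<And>x. Z \<inter> conn (ends G) (ground M - {e}) `` {x} \<noteq> {} \<Longrightarrow>
      e \<in> closure_of M {f \<in> ground M - {e}. ends G f \<subseteq> conn (ends G) (ground M - {e}) `` {x}}"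
    and star_notin: "\<And>w. w \<in> verts G \<Longrightarrow> w \<notin> Z \<Longrightarrow> e \<in> closure_of M {f \<in> ground M - {e}. w \<notin> ends G f}"
    and star_in: "\<And>w. w \<in> Z \<Longrightarrow> e \<in> closure_of M {f \<in> ground M - {e}. w \<notin> ends G f} \<Longrightarrow> Z = {w}"
    and circ: "\<And>C x y z. circuit M C \<Longrightarrow> e \<in> C \<Longrightarrow>
      {x, y, z} \<subseteq> (\<Union>f\<in>C - {e}. ends G f) \<union> Z \<Longrightarrow>
      (x, y) \<in> conn ((ends G)(e := Z)) C \<or> (x, z) \<in> conn ((ends G)(e := Z)) C
        \<or> (y, z) \<in> conn ((ends G)(e := Z)) C"
  shows "framework M (add_edge G e Z)"
proof -
  interpret N: framed_matroid "delete M {e}" G using framed_matroid_delete[OF fw] .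
  let ?n = "ends G" and ?n' = "(ends G)(e := Z)" and ?E = "ground M - {e}"
  have gr: "ground (delete M {e}) = ?E" by (simp add: delete_def)
  have E: "edges G = ?E" using N.edges_eq gr by simp
  have G': "verts (add_edge G e Z) = verts G" "edges (add_edge G e Z) = ground M"
    "ends (add_edge G e Z) = ?n'"
    using e E by (auto simp: add_edge_def)
  have conn: "conn ?n' (ground M) = conn ?n ?E"
  proof (rule rtrancl_subset)
    show "adj ?n ?E \<subseteq> adj ?n' (ground M)" by (auto simp: adj_def)
    show "adj ?n' (ground M) \<subseteq> conn ?n ?E"
    proof
      fix p assume "p \<in> adj ?n' (ground M)"
      then obtain x y f where "p = (x, y)" "f \<in> ground M" "?n' f = {x, y}" unfolding adj_def by auto
      then show "p \<in> conn ?n ?E"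
        using conn_Z[of x y] conn_edge[of f ?E ?n x y] by (cases "f = e") auto
    qed
  qed
  have rk: "rank_of (delete M {e}) A = rank_of M A" if "A \<subseteq> ?E" for A
    using that by (intro rank_of_delete) auto
  show ?thesis
    unfolding framework_iff G' conn
  proof (intro conjI ballI allI impI refl)
    show "multigraph (add_edge G e Z)"
      unfolding multigraph_def G' using N.finite_verts finite_ground N.ends_subset N.card_ends Z E by auto
  next
    fix x assume x: "x \<in> verts G"
    let ?W = "conn ?n ?E `` {x}"
    have "rank_of (delete M {e}) {f \<in> ?E. ?n f \<subseteq> ?W} = rank_of M {f \<in> ?E. ?n f \<subseteq> ?W}"
      by (rule rk) auto
    then have "rank_of M {f \<in> ?E. ?n f \<subseteq> ?W} \<le> card ?W"
      using N.rank_of_span_le[of x ?W] x gr by simp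
    moreover have "rank_of M (insert e {f \<in> ?E. ?n f \<subseteq> ?W}) = rank_of M {f \<in> ?E. ?n f \<subseteq> ?W}"
      if "Z \<subseteq> ?W"
    proof -
      have "Z \<noteq> {}" using Z(2) by auto
      then show ?thesis using span[of x] that by (auto simp: in_closure_of)
    qed
    moreover have "{f \<in> ground M. ?n' f \<subseteq> ?W} =
        (if Z \<subseteq> ?W then insert e {f \<in> ?E. ?n f \<subseteq> ?W} else {f \<in> ?E. ?n f \<subseteq> ?W})"
      using e by auto
    ultimately show "rank_of M {f \<in> ground M. ?n' f \<subseteq> ?W} \<le> card ?W" 
      by (cases "Z \<subseteq> ?W") (simp_all only: if_True if_False simp_thms)
  next
    fix w f assume w: "w \<in> verts G" and f: "f \<in> closure_of M {f \<in> ground M. w \<notin> ?n' f}" "w \<in> ?n' f"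
    let ?A = "{f \<in> ?E. w \<notin> ?n f}"
    have A: "{f \<in> ground M. w \<notin> ?n' f} = (if w \<in> Z then ?A else insert e ?A)" using e by auto
    have "insert e ?A \<subseteq> closure_of M ?A" if "w \<notin> Z"
      using star_notin[OF w that] closure_of_extensive[of ?A] by auto
    then have fA: "f \<in> closure_of M ?A"
      using f(1) A closure_of_subset_closure[of "insert e ?A" ?A] by (auto split: if_splits)
    show "?n' f = {w}"
    proof (cases "f = e")
      case True
      then show ?thesis using fA f(2) star_in[of w] by simp
    next
      case False
      then have "f \<in> closure_of (delete M {e}) ?A" using fA by (subst closure_of_delete) auto
      then show ?thesis using N.star_loop[of w f] w f(2) False gr by simp
    qed
  next
    fix C x y z
    assume C: "circuit M C" and xyz: "x \<in> (\<Union>e\<in>C. ?n' e)" "y \<in> (\<Union>e\<in>C. ?n' e)" "z \<in> (\<Union>e\<in>C. ?n' e)"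
    show "(x, y) \<in> conn ?n' C \<or> (x, z) \<in> conn ?n' C \<or> (y, z) \<in> conn ?n' C"
    proof (cases "e \<in> C")
      case True
      then have "(\<Union>f\<in>C. ?n' f) = (\<Union>f\<in>C - {e}. ?n f) \<union> Z" by (auto split: if_splits)
      then show ?thesis using circ[OF C True, of x y z] xyz by simp
    next
      case False
      then have "(\<Union>f\<in>C. ?n' f) = (\<Union>f\<in>C. ?n f)" "adj ?n' C = adj ?n C"
        by (auto intro!: adj_cong split: if_splits)
      moreover have "circuit (delete M {e}) C" using C False by (simp add: circuit_delete)
      ultimately show ?thesis using N.circuit_conn[of C x y z] xyz by simp
    qed
  qed
qed

text \<open>As \<open>e\<close> lies in every closure, it has to be a loop of the graph, and any
  vertex will do because its only circuit is \<open>{e}\<close>. The element \<open>f\<close>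
  guarantees that there is a vertex.\<close>

lemma framework_add_matroid_loop:
  assumes e: "e \<in> ground M" "{e} \<notin> indeps M" and f: "f \<in> ground M" "f \<noteq> e"
    and fw: "framework (delete M {e}) G"
  shows "\<exists>Z. framework M (add_edge G e Z)"
proof -
  interpret N: framed_matroid "delete M {e}" G using framed_matroid_delete[OF fw] .
  obtain v where v: "v \<in> ends G f"
    using f N.ends_cases[of f] by (auto simp: delete_def)
  then have "v \<in> verts G" using f N.ends_subset_verts[of f] by (auto simp: delete_def)
  have "e \<in> closure_of M {}" using indep_insert_iff[OF empty_indep e(1)] e(2) by simp
  then have cl: "e \<in> closure_of M X" for X using closure_of_mono[of "{}" X] by auto
  have "framework M (add_edge G e {v})"
  proof (rule framework_add_edge[OF e(1) fw])
    fix C x y z assume C: "circuit M C" "e \<in> C" "{x, y, z} \<subseteq> (\<Union>f\<in>C - {e}. ends G f) \<union> {v}"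
    then have "C = {e}" using e(2) circuit_indep[OF C(1), of "{e}"] by auto
    then show "(x, y) \<in> conn ((ends G)(e := {v})) C \<or> (x, z) \<in> conn ((ends G)(e := {v})) C
        \<or> (y, z) \<in> conn ((ends G)(e := {v})) C"
      using C(3) by auto
  qed (use cl \<open>v \<in> verts G\<close> in auto)
  then show ?thesis by blast
qed

text \<open>The new edge copies the ends of \<open>f\<close>: closures contain \<open>e\<close>
  exactly when they contain \<open>f\<close>, and exchanging the two turns circuits through
  \<open>e\<close> alone into circuits through \<open>f\<close>. The only circuit through both is
  \<open>{e, f}\<close>.\<close>

lemma framework_add_parallel:
  assumes e: "e \<in> ground M" and f: "f \<in> ground M" "f \<noteq> e"
    and par: "{e, f} \<notin> indeps M" "{e} \<in> indeps M" "{f} \<in> indeps M"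
    and fw: "framework (delete M {e}) G"
  shows "\<exists>Z. framework M (add_edge G e Z)"
proof -
  interpret N: framed_matroid "delete M {e}" G using framed_matroid_delete[OF fw] .
  let ?n = "ends G" and ?E = "ground M - {e}"
  let ?Z = "?n f" and ?n' = "?n(e := ?n f)"
  have gr: "ground (delete M {e}) = ?E" by (simp add: delete_def)
  have fE: "f \<in> ?E" using f by simp
  obtain a b where ab: "?n f = {a, b}" using N.ends_cases fE gr by metis
  have ef: "e \<in> closure_of M {f}" "f \<in> closure_of M {e}"
    using indep_insert_iff[OF par(3) e] indep_insert_iff[OF par(2) f(1)] par(1) f(2)
    by (auto simp: insert_commute)
  have e_cl: "e \<in> closure_of M X" if "f \<in> closure_of M X" for X
    using ef(1) closure_of_subset_closure[of "{f}" X] that by auto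
  have f_cl: "f \<in> closure_of M X" if "e \<in> closure_of M X" for X
    using ef(2) closure_of_subset_closure[of "{e}" X] that by auto
  have "framework M (add_edge G e ?Z)"
  proof (rule framework_add_edge[OF e fw])
    show "?Z \<subseteq> verts G" using N.ends_subset_verts fE gr by simp
    show "card ?Z \<in> {1, 2}" using N.card_ends[of f] N.edges_eq fE gr by simp
    show "(x, y) \<in> conn ?n ?E" if "x \<in> ?Z" "y \<in> ?Z" for x y
      using that ab conn_edge[OF fE, of ?n a b] conn_edge[OF fE, of ?n b a] by (auto simp: insert_commute)
    show "e \<in> closure_of M {g \<in> ?E. ?n g \<subseteq> conn ?n ?E `` {x}}" if "?Z \<inter> conn ?n ?E `` {x} \<noteq> {}" for x
    proof (rule e_cl)
      have "?n f \<subseteq> conn ?n ?E `` {x}"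
        using N.ends_subset_conn_class[of ?E f x] fE gr that by simp
      then show "f \<in> closure_of M {g \<in> ?E. ?n g \<subseteq> conn ?n ?E `` {x}}"
        using fE closure_of_extensive[of "{g \<in> ?E. ?n g \<subseteq> conn ?n ?E `` {x}}"] by auto
    qed
    show "e \<in> closure_of M {g \<in> ?E. w \<notin> ?n g}" if "w \<notin> ?Z" for w
      by (rule e_cl) (use fE that closure_of_extensive[of "{g \<in> ?E. w \<notin> ?n g}"] in auto)
    show "?Z = {w}" if w: "w \<in> ?Z" "e \<in> closure_of M {g \<in> ?E. w \<notin> ?n g}" for w
    proof (rule N.star_loop)
      show "w \<in> verts G" using N.ends_subset_verts[of f] fE gr w(1) by auto
      show "f \<in> closure_of (delete M {e}) {g \<in> ground (delete M {e}). w \<notin> ?n g}"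
        using f_cl[OF w(2)] f(2) gr by (subst closure_of_delete) auto
    qed fact
  next
    fix C x y z assume C: "circuit M C" "e \<in> C" and xyz: "{x, y, z} \<subseteq> (\<Union>f\<in>C - {e}. ?n f) \<union> ?Z"
    let ?B = "C - {e}"
    show "(x, y) \<in> conn ?n' C \<or> (x, z) \<in> conn ?n' C \<or> (y, z) \<in> conn ?n' C"
    proof (cases "f \<in> C")
      case True
      then have "C = {e, f}" using C par(1) circuit_indep[OF C(1), of "{e, f}"] by auto
      then have "{x, y, z} \<subseteq> {a, b}" using xyz ab f(2) by auto
      moreover have "(a, b) \<in> conn ?n' C" using C(2) ab by (intro conn_edge[of e]) auto
      moreover from this have "(b, a) \<in> conn ?n' C" by (rule conn_sym)
      ultimately show ?thesis by auto
    next
      case False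
      have "circuit M (insert f ?B)"
      proof (rule circuit_insertI)
        show "?B \<in> indeps M" using C by (intro circuit_indep[OF C(1)]) auto
        show "f \<in> closure_of M ?B" using f_cl circuit_in_closure[OF C] by simp
        show "f \<notin> closure_of M (?B - {b})" if "b \<in> ?B" for b
          using e_cl[of "?B - {b}"] circuit_not_in_closure[OF C, of b] that by auto
      qed (use False in auto)
      then have "circuit (delete M {e}) (insert f ?B)" using f(2) by (simp add: circuit_delete)
      then have "(x, y) \<in> conn ?n (insert f ?B) \<or> (x, z) \<in> conn ?n (insert f ?B)
          \<or> (y, z) \<in> conn ?n (insert f ?B)"
        by (rule N.circuit_conn) (use xyz in auto)
      moreover have "adj ?n (insert f ?B) = adj ?n' C"
        using C(2) by (auto simp: adj_def)
      ultimately show ?thesis by simp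
    qed
  qed
  then show ?thesis by blast
qed

end

section \<open>Replacing an element by generic elements of a line\<close>

context matroid
begin

lemma simple_line_closure:
  assumes "simple M" "A \<subseteq> ground M" "rank_of M A \<le> 2" "f \<in> A" "g \<in> A" "f \<noteq> g"
  shows "A \<subseteq> closure_of M {f, g}"
proof
  fix h assume h: "h \<in> A"
  have "{f, g} \<in> indeps M" using assms by (auto simp: simple_def)
  then have "rank_of M {f, g} = 2" using rank_of_indep[of "{f, g}"] assms(6) by simp
  moreover have "rank_of M (insert h {f, g}) \<le> rank_of M A"
    using h assms by (intro rank_of_mono) auto
  ultimately have "rank_of M (insert h {f, g}) = rank_of M {f, g}"
    using assms(3) rank_of_le_insert[of "{f, g}" h] by simp
  with h assms(2) show "h \<in> closure_of M {f, g}" by (auto simp: in_closure_of)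
qed

text \<open>Any two elements of \<open>L\<close> span \<open>e\<close>. If \<open>C - {e}\<close>
  spans \<open>L\<close>, one generic element replaces \<open>e\<close>; otherwise it spans at most
  one element of \<open>L\<close>, and two elements outside its span replace \<open>e\<close>. The
  first case needs more than \<open>rank_of M (ground M)\<close> elements, the second needs three;
  the bound on \<open>card L\<close> covers both.\<close>

lemma circuit_replace_by_line:
  assumes simple: "simple M" and C: "circuit M C" "e \<in> C"
    and L: "L \<subseteq> ground M" "e \<notin> L" "rank_of M (insert e L) \<le> 2" "rank_of M (ground M) + 2 < card L"
  shows "\<exists>D\<subseteq>L. D \<noteq> {} \<and> (C - {e}) \<inter> D = {} \<and> circuit M ((C - {e}) \<union> D)"
proof -
  define B where "B = C - {e}"
  have B: "B \<in> indeps M" "e \<in> closure_of M B"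
    using C circuit_in_closure circuit_indep[of C "C - {e}"] by (auto simp: B_def)
  have Bsub: "B \<subseteq> ground M" using B(1) indeps_subset by auto
  have e_notin: "e \<notin> closure_of M (B - {b})" if "b \<in> B" for b
    using that circuit_not_in_closure[OF C, of b] by (auto simp: B_def)
  have eM: "e \<in> ground M" using C by (auto simp: circuit_def)
  have finL: "finite L" using L(1) finite_ground finite_subset by blast
  have two: "insert e L \<subseteq> closure_of M X" if "f \<in> insert e L" "g \<in> insert e L" "f \<noteq> g"
    "f \<in> closure_of M X" "g \<in> closure_of M X" for f g X
  proof -
    have "insert e L \<subseteq> closure_of M {f, g}"
      using simple_line_closure[OF simple, of "insert e L" f g] L eM that by auto
    then show ?thesis using closure_of_subset_closure[of "{f, g}" X] that by auto
  qed
  have B_closure: "B \<subseteq> closure_of M B" by (rule closure_of_extensive[OF Bsub])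
  show ?thesis
  proof (cases "L \<subseteq> closure_of M B")
    case True
    \<comment> \<open>An element of \<open>L\<close> fails to replace \<open>e\<close> if it is
      already spanned after dropping some \<open>b\<close>. Each \<open>b\<close> spoils at most one
      element, since two would span \<open>e\<close> without \<open>b\<close>.\<close>
    let ?bad = "\<Union>b\<in>B. L \<inter> closure_of M (B - {b})"
    have "card (L \<inter> closure_of M (B - {b})) \<le> 1" if "b \<in> B" for b
    proof (rule ccontr)
      assume "\<not> ?thesis"
      then obtain f g where "f \<in> L" "g \<in> L" "f \<noteq> g"
        "f \<in> closure_of M (B - {b})" "g \<in> closure_of M (B - {b})"
        using card_le_Suc0_iff_eq[of "L \<inter> closure_of M (B - {b})"] finL by auto
      then show False using two[of f g "B - {b}"] e_notin[OF that] by auto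
    qed
    then have "card ?bad \<le> (\<Sum>b\<in>B. 1)"
      using finite_indep[OF B(1)] by (intro order_trans[OF card_UN_le] sum_mono) auto
    also have "\<dots> \<le> rank_of M (ground M)" using card_le_rank_of[OF B(1) Bsub] by simp
    finally have "card ?bad < card L" using L(4) by simp
    then have "\<not> L \<subseteq> ?bad" using finL finite_indep[OF B(1)] card_mono[of ?bad L] by auto
    then obtain f where f: "f \<in> L" "\<And>b. b \<in> B \<Longrightarrow> f \<notin> closure_of M (B - {b})" by blast
    have "f \<notin> B"
    proof
      assume "f \<in> B"
      have "card C = Suc (card B)"
        using card_Suc_Diff1[OF circuit_finite[OF C(1)] C(2)] by (simp only: B_def)
      then have "\<not> B \<subseteq> {f}" using circuit_card_ge_3[OF simple C(1)] card_mono[of "{f}" B] by auto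
      then obtain b where "b \<in> B" "b \<noteq> f" by auto
      then show False using f(2)[of b] closure_of_extensive[of "B - {b}"] \<open>f \<in> B\<close> Bsub by auto
    qed
    then have "circuit M (insert f B)"
      using B(1) f True by (intro circuit_insertI) auto
    then show ?thesis using f(1) \<open>f \<notin> B\<close> by (intro exI[of _ "{f}"]) (auto simp: B_def)
  next
    case False
    have "card (L \<inter> closure_of M B) \<le> 1"
    proof (rule ccontr)
      assume "\<not> ?thesis"
      then obtain f g where "f \<in> L" "g \<in> L" "f \<noteq> g" "f \<in> closure_of M B" "g \<in> closure_of M B"
        using card_le_Suc0_iff_eq[of "L \<inter> closure_of M B"] finL by auto
      then show False using two[of f g B] False by auto
    qed
    then have "\<not> card (L - closure_of M B) \<le> 1"
      using L(4) finL by (simp add: card_Diff_subset_Int)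
    then obtain f g where fg: "f \<in> L" "g \<in> L" "f \<noteq> g" "f \<notin> closure_of M B" "g \<notin> closure_of M B"
      using card_le_Suc0_iff_eq[of "L - closure_of M B"] finL by auto
    have notB: "f \<notin> B" "g \<notin> B" using fg B_closure by auto
    have "circuit M (insert g (insert f B))"
    proof (rule circuit_insertI)
      show "insert f B \<in> indeps M" using indep_insert_iff[OF B(1), of f] fg L notB by auto
      have "e \<in> closure_of M (insert f B)" "f \<in> closure_of M (insert f B)"
        using B(2) closure_of_mono[of B "insert f B"] closure_of_extensive[of "insert f B"]
          Bsub fg L by auto
      then show "g \<in> closure_of M (insert f B)" using two[of e f "insert f B"] fg L by auto
      show "g \<notin> insert f B" using fg notB by auto
      show "g \<notin> closure_of M (insert f B - {b})" if "b \<in> insert f B" for b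
      proof (cases "b = f")
        case True
        then show ?thesis using notB fg by simp
      next
        case False
        then have b: "b \<in> B" and eq: "insert f B - {b} = insert f (B - {b})" using that by auto
        show ?thesis
        proof
          assume "g \<in> closure_of M (insert f B - {b})"
          moreover have "f \<in> closure_of M (insert f B - {b})"
            using eq closure_of_extensive[of "insert f (B - {b})"] Bsub fg L by auto
          \<comment> \<open>From here exchange puts \<open>f\<close> into the closure of
            \<open>insert e (B - {b})\<close>, hence of \<open>B\<close>, against its
            choice.\<close>
          ultimately have "e \<in> closure_of M (insert f (B - {b}))"
            using two[of f g "insert f B - {b}"] fg eq by auto
          then have "f \<in> closure_of M (insert e (B - {b}))"
            using closure_of_exchange[of e f "B - {b}"] e_notin[OF b] fg L by auto
          moreover have "insert e (B - {b}) \<subseteq> closure_of M B" using B(2) B_closure by auto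
          ultimately show False using closure_of_subset_closure fg(4) by blast
        qed
      qed
    qed
    then show ?thesis using fg notB by (intro exI[of _ "{f, g}"]) (auto simp: B_def insert_commute)
  qed
qed

text \<open>The two options for \<open>Z\<close> are those compatible with the closure condition at
  \<open>u\<close> and \<open>v\<close>; at other vertices the elements of \<open>L\<close> span
  \<open>e\<close>. For circuits, \<open>e\<close> is replaced by some
  \<open>D \<subseteq> L\<close>. The edge \<open>uv\<close> then gives the same connectivity as
  \<open>D\<close>, whereas the loop needs \<open>circuit_bridge_class\<close>.\<close>

lemma framework_add_line_element_aux:
  assumes simple: "simple M" and e: "e \<in> ground M" and fw: "framework (delete M {e}) G"
    and uv: "u \<noteq> v" and L: "L \<subseteq> {f \<in> ground M - {e}. ends G f = {u, v}}"
    and line: "rank_of M (insert e L) \<le> 2" "rank_of M (ground M) + 2 < card L"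
    and Z: "Z = {v} \<and> e \<in> closure_of M {f \<in> ground M - {e}. u \<notin> ends G f}
      \<or> Z = {u, v} \<and> (\<forall>w\<in>{u, v}. e \<notin> closure_of M {f \<in> ground M - {e}. w \<notin> ends G f})"
  shows "framework M (add_edge G e Z)"
proof (rule framework_add_edge[OF e fw])
  interpret N: framed_matroid "delete M {e}" G using framed_matroid_delete[OF fw] .
  let ?n = "ends G" and ?E = "ground M - {e}"
  have gr: "ground (delete M {e}) = ?E" by (simp add: delete_def)
  have L': "L \<subseteq> ground M" "e \<notin> L" using L by auto
  obtain f g where fg: "f \<in> L" "g \<in> L" "f \<noteq> g"
    using card_le_Suc0_iff_eq[of L] line(2) finite_subset[OF L'(1) finite_ground] by auto
  have "insert e L \<subseteq> closure_of M {f, g}"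
    using simple_line_closure[OF simple, of "insert e L" f g] L' fg line(1) e by auto
  then have e_cl: "e \<in> closure_of M X" if "L \<subseteq> X" for X
    using closure_of_mono[of "{f, g}" X] fg that by auto
  have fE: "f \<in> ?E" "?n f = {u, v}" using fg(1) L by auto
  then have uvV: "{u, v} \<subseteq> verts G" using N.ends_subset_verts[of f] gr by auto
  have ZV: "Z \<subseteq> {u, v}" using Z by auto
  have conn_uv: "(u, v) \<in> conn ?n ?E" using fE by (intro conn_edge) auto
  have conn_vu: "(v, u) \<in> conn ?n ?E" using conn_uv by (rule conn_sym)
  show "Z \<subseteq> verts G" using ZV uvV by auto
  show "card Z \<in> {1, 2}" using Z uv by auto
  show "(x, y) \<in> conn ?n ?E" if "x \<in> Z" "y \<in> Z" for x y
    using that ZV conn_uv conn_vu by auto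
  show "e \<in> closure_of M {h \<in> ?E. ?n h \<subseteq> conn ?n ?E `` {x}}" if "Z \<inter> conn ?n ?E `` {x} \<noteq> {}" for x
  proof (rule e_cl)
    have "{u, v} \<subseteq> conn ?n ?E `` {x}"
      using N.ends_subset_conn_class[of ?E f x] fE gr that ZV by auto
    then show "L \<subseteq> {h \<in> ?E. ?n h \<subseteq> conn ?n ?E `` {x}}" using L by auto
  qed
  show "e \<in> closure_of M {h \<in> ?E. w \<notin> ?n h}" if "w \<notin> Z" for w
  proof (cases "w \<in> {u, v}")
    case True
    then have "w = u" "Z = {v}" using that Z by auto
    then show ?thesis using Z uv by auto
  next
    case False
    then show ?thesis using L by (intro e_cl) auto
  qed
  show "Z = {w}" if "w \<in> Z" "e \<in> closure_of M {h \<in> ?E. w \<notin> ?n h}" for w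
    using Z that by auto
next
  interpret N: framed_matroid "delete M {e}" G using framed_matroid_delete[OF fw] .
  let ?n = "ends G"
  let ?n' = "?n(e := Z)"
  have gr: "ground (delete M {e}) = ground M - {e}" by (simp add: delete_def)
  fix C x y z
  assume C: "circuit M C" "e \<in> C" and xyz: "{x, y, z} \<subseteq> (\<Union>f\<in>C - {e}. ?n f) \<union> Z"
  define B where "B = C - {e}"
  obtain D where D: "D \<subseteq> L" "D \<noteq> {}" "B \<inter> D = {}" "circuit M (B \<union> D)"
    using circuit_replace_by_line[OF simple C, of L] L line unfolding B_def by auto
  have nD: "?n d = {u, v}" if "d \<in> D" for d using that D(1) L by auto
  obtain d where d: "d \<in> D" using D(2) by auto
  have CN: "circuit (delete M {e}) (B \<union> D)"
    using D L by (auto simp: circuit_delete B_def)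
  have CB: "C = insert e B" using C(2) by (auto simp: B_def)
  have n'B: "?n' f = ?n f" if "f \<in> B" for f using that by (auto simp: B_def)
  have "{x, y, z} \<subseteq> (\<Union>f\<in>B \<union> D. ?n f)"
    using xyz Z d nD[OF d] unfolding B_def by auto
  then have BD: "(x, y) \<in> conn ?n (B \<union> D) \<or> (x, z) \<in> conn ?n (B \<union> D) \<or> (y, z) \<in> conn ?n (B \<union> D)"
    by (intro N.circuit_conn[OF CN]) auto
  show "(x, y) \<in> conn ?n' C \<or> (x, z) \<in> conn ?n' C \<or> (y, z) \<in> conn ?n' C"
  proof (cases "Z = {v}")
    case False
    then have "Z = {u, v}" using Z by auto
    then have "adj ?n (B \<union> D) = adj ?n' (B \<union> {e})"
      using D(2) adj_cong[of B ?n ?n'] n'B adj_cong[of D ?n "\<lambda>_. Z"] nD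
      by (simp add: adj_Un) (auto simp: adj_def)
    then have "adj ?n (B \<union> D) = adj ?n' C" by (simp add: CB)
    with BD show ?thesis by simp
  next
    case True
    have "adj ?n B \<subseteq> adj ?n' C" using n'B unfolding CB adj_def by auto
    then have B_C: "conn ?n B \<subseteq> conn ?n' C" by (rule rtrancl_mono)
    have join: "(a, b) \<in> conn ?n B" if "(w, a) \<in> conn ?n B" "(w, b) \<in> conn ?n B" for w a b
      using conn_sym[OF that(1)] that(2) by (rule rtrancl_trans)
    \<comment> \<open>All edges of \<open>D\<close> join \<open>u\<close> and \<open>v\<close>, so
      adding them to \<open>B\<close> can only merge the classes of these two vertices.\<close>
    have cases: "(a, b) \<in> conn ?n B \<or> (u, a) \<in> conn ?n B \<and> (v, b) \<in> conn ?n B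
        \<or> (v, a) \<in> conn ?n B \<and> (u, b) \<in> conn ?n B"
      if "(a, b) \<in> conn ?n (B \<union> D)" for a b
    proof -
      let ?K = "\<lambda>w. conn ?n B `` {w}"
      have K: "?n f \<subseteq> ?K w" if "f \<in> B" "?n f \<inter> ?K w \<noteq> {}" for f w
        using that CN by (intro N.ends_subset_conn_class) (auto simp: circuit_def)
      show ?thesis
      proof (cases "a \<in> ?K u \<union> ?K v")
        case True
        have "b \<in> ?K u \<union> ?K v"
        proof (rule conn_closed[OF that True])
          fix f assume f: "f \<in> B \<union> D" "?n f \<inter> (?K u \<union> ?K v) \<noteq> {}"
          show "?n f \<subseteq> ?K u \<union> ?K v"
          proof (cases "f \<in> B")
            case True
            then show ?thesis using f K[of f u] K[of f v] by auto
          qed (use f nD[of f] in auto)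
        qed
        then show ?thesis using True join[of u a b] join[of v a b] by auto
      next
        case False
        have "b \<in> ?K a"
        proof (rule conn_closed[OF that])
          fix f assume f: "f \<in> B \<union> D" "?n f \<inter> ?K a \<noteq> {}"
          have "f \<notin> D" using f(2) False nD[of f] conn_sym[of a u ?n B] conn_sym[of a v ?n B] by auto
          then show "?n f \<subseteq> ?K a" using f K by auto
        qed simp
        then show ?thesis by simp
      qed
    qed
    show ?thesis
    proof (rule ccontr)
      assume "\<not> ?thesis"
      then have neg: "(x, y) \<notin> conn ?n B" "(x, z) \<notin> conn ?n B" "(y, z) \<notin> conn ?n B"
        using B_C by auto
      \<comment> \<open>Some pair is connected in \<open>B \<union> D\<close> but not in
        \<open>B\<close>, so its connection uses \<open>D\<close>; up to order, one vertex lies in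
        the class of \<open>u\<close> and the other in that of \<open>v\<close>.\<close>
      then have "\<exists>p q. {p, q} \<subseteq> {x, y, z} \<and> (p, q) \<notin> conn ?n B
          \<and> (u, p) \<in> conn ?n B \<and> (v, q) \<in> conn ?n B"
        using BD cases[of x y] cases[of x z] cases[of y z] conn_sym[of _ _ ?n B] by blast
      then obtain p q where pq: "{p, q} \<subseteq> {x, y, z}" "(p, q) \<notin> conn ?n B"
        "(u, p) \<in> conn ?n B" "(v, q) \<in> conn ?n B"
        by blast
      have uv_B: "(u, v) \<notin> conn ?n B"
      proof
        assume "(u, v) \<in> conn ?n B"
        from join[OF pq(3) rtrancl_trans[OF this pq(4)]] show False using pq(2) by simp
      qed
      have "p \<noteq> v" using uv_B pq(3) by auto
      then have p: "p \<in> (\<Union>f\<in>B. ?n f)" using pq(1) xyz True by (auto simp: B_def)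
      have u: "u \<in> (\<Union>f\<in>B. ?n f)"
      proof (cases "p = u")
        case False
        then show ?thesis using conn_crossing_edge[OF pq(3), of "{u}"] by auto
      qed (use p in simp)
      \<comment> \<open>Now all three vertices lie in the two classes of \<open>u\<close> and
        \<open>v\<close>, so two of them are connected in \<open>B\<close> after all. The case
        \<open>w = v\<close> is separate because the loop may be the only edge of \<open>C\<close>
        at \<open>v\<close>.\<close>
      have "(u, w) \<in> conn ?n B \<or> (v, w) \<in> conn ?n B" if "w \<in> {x, y, z}" for w
      proof (cases "w = v")
        case False
        then have w: "w \<in> (\<Union>f\<in>B. ?n f)" using that xyz True by (auto simp: B_def)
        show ?thesis by (rule N.circuit_bridge_class[OF CN D(3) d _ u uv_B w]) (rule nD)
      qed simp
      then have "(u, x) \<in> conn ?n B \<or> (v, x) \<in> conn ?n B" "(u, y) \<in> conn ?n B \<or> (v, y) \<in> conn ?n B"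
        "(u, z) \<in> conn ?n B \<or> (v, z) \<in> conn ?n B" by simp_all
      then show False using neg join by blast
    qed
  qed
qed

text \<open>If \<open>e\<close> is spanned by the edges avoiding \<open>u\<close>, then it may not become an edge at \<open>u\<close>,
  but a loop at \<open>v\<close> is harmless.\<close>

lemma framework_add_line_element:
  assumes "simple M" "e \<in> ground M" "framework (delete M {e}) G"
    and uv: "u \<noteq> v" and L: "L \<subseteq> {f \<in> ground M - {e}. ends G f = {u, v}}"
    and line: "rank_of M (insert e L) \<le> 2" "rank_of M (ground M) + 2 < card L"
  shows "\<exists>Z. framework M (add_edge G e Z)"
proof -
  let ?S = "\<lambda>w. closure_of M {f \<in> ground M - {e}. w \<notin> ends G f}"
  note add = framework_add_line_element_aux[OF assms(1-3)]
  consider "e \<in> ?S u" | "e \<in> ?S v" | "e \<notin> ?S u" "e \<notin> ?S v" by blast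
  then show ?thesis
  proof cases
    case 1
    then show ?thesis using add[OF uv L line, of "{v}"] by blast
  next
    case 2
    then show ?thesis using add[OF uv[symmetric] _ line, of "{u}"] L by (auto simp: insert_commute)
  next
    case 3
    then show ?thesis using add[OF uv L line, of "{u, v}"] by blast
  qed
qed

lemma simple_delete: "simple M \<Longrightarrow> simple (delete M D)"
  by (auto simp: simple_def delete_def)

end

section \<open>Bounding the size of an excluded minor\<close>

lemma exists_large_parallel_class_delete:
  assumes "matroid M" "simple M" "framework (delete M {e}) G" "S \<subseteq> ground M - {e}"
    and "rank M + 4 ^ rank M * k < card S"
  shows "\<exists>u v. u \<noteq> v \<and> k < card {f \<in> S. ends G f = {u, v}}
    \<and> rank_of M {f \<in> S. ends G f = {u, v}} \<le> 2"
proof -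
  interpret matroid M by fact
  interpret N: framed_matroid "delete M {e}" G using framed_matroid_delete assms(3) .
  let ?r = "rank_of (delete M {e}) (ground (delete M {e}))"
  have gr: "ground (delete M {e}) = ground M - {e}" by (simp add: delete_def)
  have "?r = rank_of M (ground M - {e})" unfolding gr by (rule rank_of_delete) auto
  then have "?r \<le> rank M" unfolding rank_def using rank_of_mono[of "ground M - {e}" "ground M"] by auto
  then have "?r + 4 ^ ?r * k \<le> rank M + 4 ^ rank M * k"
    by (intro add_mono mult_right_mono power_increasing) auto
  then obtain u v where uv: "u \<noteq> v" "k < card {f \<in> S. ends G f = {u, v}}"
    using N.exists_large_parallel_class[OF simple_delete[OF assms(2)], of S k] assms(4,5) gr by auto
  let ?P = "{f \<in> S. ends G f = {u, v}}"
  have "rank_of M ?P = rank_of (delete M {e}) ?P"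
    using assms(4) by (intro rank_of_delete[symmetric]) auto
  also have "\<dots> \<le> rank_of (delete M {e}) {f \<in> ground (delete M {e}). ends G f = {u, v}}"
    using assms(4) gr by (intro N.rank_of_mono) auto
  also have "\<dots> \<le> 2" using uv(1) by (rule N.rank_of_parallel_class_le)
  finally show ?thesis using uv by blast
qed

text \<open>A matroid loop or one of two parallel elements could be put back into a framework of its
  deletion. Positive rank provides a non-loop element, so that this framework has a vertex to carry
  the loop.\<close>

lemma excluded_minor_quasi_graphic_simple:
  assumes M: "excluded_minor quasi_graphic M" "rank M > 0"
  shows "simple M"
proof -
  interpret matroid M using M by (simp add: excluded_minor_def)
  have del: "\<exists>G :: (nat, 'a) pre_multigraph. framework (delete M {e}) G" if "e \<in> ground M" for e
    using M(1) proper_minor_delete[OF that] by (auto simp: excluded_minor_def quasi_graphic_def)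
  have no_framework: "\<not> framework M G" for G :: "(nat, 'a) pre_multigraph"
    using M(1) matroid_axioms by (auto simp: excluded_minor_def quasi_graphic_def)
  have single: "{e} \<in> indeps M" if e: "e \<in> ground M" for e
  proof (rule ccontr)
    assume dep: "{e} \<notin> indeps M"
    obtain B where B: "B \<in> indeps M" "card B = rank M"
      using rank_of_witness[of "ground M"] by (auto simp: rank_def)
    then have "B \<noteq> {}" using M(2) by auto
    then obtain f where f: "f \<in> B" by auto
    then have "{f} \<in> indeps M" using subset_indep[OF B(1)] by auto
    then have "f \<in> ground M" "f \<noteq> e" using dep indeps_subset by auto
    then show False using framework_add_matroid_loop[OF e dep] del[OF e] no_framework by blast
  qed
  have "{e, f} \<in> indeps M" if "e \<in> ground M" "f \<in> ground M" "f \<noteq> e" for e f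
    using framework_add_parallel[OF that _ single single] del[OF that(1)] no_framework that by blast
  with single show ?thesis unfolding simple_def by (metis insert_absorb2)
qed

text \<open>The bound unfolds from the inside: more than \<open>r + 2\<close> parallel elements are
  needed to put an element back; one pigeonhole step asks for more than
  \<open>r + 4 ^ r * (r + 2)\<close> elements of the line, and \<open>Suc\<close> for the deleted
  \<open>e'\<close>; a second step finds such a line, and the outer \<open>Suc\<close> is for the
  deleted \<open>e\<close>.\<close>

lemma excluded_minor_quasi_graphic_card_le:
  assumes M: "excluded_minor quasi_graphic M" "rank M = r" "r > 0"
  shows "card (ground M) \<le> Suc (r + 4 ^ r * (Suc (r + 4 ^ r * (r + 2))))"
proof (rule ccontr)
  assume large: "\<not> ?thesis"
  interpret matroid M using M by (simp add: excluded_minor_def)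
  have simple: "simple M" using excluded_minor_quasi_graphic_simple M by auto
  have del: "\<exists>G :: (nat, 'a) pre_multigraph. framework (delete M {e}) G" if "e \<in> ground M" for e
    using M(1) proper_minor_delete[OF that] by (auto simp: excluded_minor_def quasi_graphic_def)
  note dense = exists_large_parallel_class_delete[OF matroid_axioms simple, unfolded M(2)]
  have "ground M \<noteq> {}" using large by auto
  then obtain e where e: "e \<in> ground M" by auto
  obtain G :: "(nat, 'a) pre_multigraph" where G: "framework (delete M {e}) G" using del[OF e] by blast
  have "r + 4 ^ r * (Suc (r + 4 ^ r * (r + 2))) < card (ground M - {e})"
    using large card_Suc_Diff1[OF finite_ground e] by simp
  from dense[OF G order_refl this]
  obtain u v where uv: "Suc (r + 4 ^ r * (r + 2)) < card {f \<in> ground M - {e}. ends G f = {u, v}}"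
    "rank_of M {f \<in> ground M - {e}. ends G f = {u, v}} \<le> 2"
    by (elim exE conjE)
  define L where "L = {f \<in> ground M - {e}. ends G f = {u, v}}"
  have L: "L \<subseteq> ground M" "Suc (r + 4 ^ r * (r + 2)) < card L" "rank_of M L \<le> 2"
    using uv by (auto simp: L_def)
  then have "L \<noteq> {}" by auto
  then obtain e' where e': "e' \<in> L" by auto
  obtain G' :: "(nat, 'a) pre_multigraph" where G': "framework (delete M {e'}) G'"
    using del e' L(1) by blast
  have card: "r + 4 ^ r * (r + 2) < card (L - {e'})"
    using L card_Suc_Diff1[OF finite_subset[OF L(1) finite_ground] e'] by simp
  have "L - {e'} \<subseteq> ground M - {e'}" using L(1) by auto
  \<comment> \<open>The search is confined to \<open>L - {e'}\<close>, so the parallel class found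
    in \<open>G'\<close> spans a line through \<open>e'\<close>.\<close>
  from dense[OF G' this card]
  obtain u v where uv: "u \<noteq> v" "r + 2 < card {f \<in> L - {e'}. ends G' f = {u, v}}"
    by (elim exE conjE)
  let ?L' = "{f \<in> L - {e'}. ends G' f = {u, v}}"
  have "\<exists>Z. framework M (add_edge G' e' Z)"
  proof (rule framework_add_line_element[OF simple _ G' uv(1)])
    show "e' \<in> ground M" using e' L(1) by auto
    show "?L' \<subseteq> {f \<in> ground M - {e'}. ends G' f = {u, v}}" using L(1) by auto
    have "rank_of M (insert e' ?L') \<le> rank_of M L" using e' by (intro rank_of_mono) auto
    with L(3) show "rank_of M (insert e' ?L') \<le> 2" by simp
    show "rank_of M (ground M) + 2 < card ?L'" using uv(2) M(2) by (simp add: rank_def)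
  qed
  then show False using M(1) by (auto simp: excluded_minor_def quasi_graphic_def)
qed

section \<open>Finitely many isomorphism classes\<close>

lemma (in matroid) indep_iff_image:
  assumes "inj_on h (ground M)" "X \<subseteq> ground M"
  shows "X \<in> indeps M \<longleftrightarrow> h ` X \<in> (`) h ` indeps M"
proof
  assume "h ` X \<in> (`) h ` indeps M"
  then obtain Y where Y: "Y \<in> indeps M" "h ` X = h ` Y" by auto
  then show "X \<in> indeps M"
    using inj_on_image_eq_iff[OF assms(1,2) indeps_subset[OF Y(1)]] by simp
qed simp

lemma isomorphic_if_same_image:
  assumes "matroid M" "matroid N"
    and h: "bij_betw h (ground M) K" and k: "bij_betw k (ground N) K"
    and eq: "(`) h ` indeps M = (`) k ` indeps N"
  shows "isomorphic M N"
  unfolding isomorphic_def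
proof (intro exI conjI allI impI)
  let ?f = "inv_into (ground N) k \<circ> h"
  show "bij_betw ?f (ground M) (ground N)" using bij_betw_trans[OF h bij_betw_inv_into[OF k]] .
  fix X assume X: "X \<subseteq> ground M"
  then have hX: "h ` X \<subseteq> k ` ground N" using h k by (auto simp: bij_betw_def)
  have "k ` ?f ` X = h ` X" using image_inv_into_cancel[OF refl hX] by (simp add: image_comp)
  moreover have "?f ` X \<subseteq> ground N" using inv_into_into[of _ k "ground N"] hX by auto
  ultimately show "X \<in> indeps M \<longleftrightarrow> ?f ` X \<in> indeps N"
    using matroid.indep_iff_image[OF assms(1) bij_betw_imp_inj_on[OF h] X]
      matroid.indep_iff_image[OF assms(2) bij_betw_imp_inj_on[OF k], of "?f ` X"] eq by simp
qed

text \<open>Transporting a matroid along a bijection from its ground set to an initial segment of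
  the naturals leaves finitely many possible families of independent sets, and equal families come
  from isomorphic matroids.\<close>

lemma finite_isomorphism_classes:
  fixes S :: "'a set_system set"
  assumes S: "\<And>M. M \<in> S \<Longrightarrow> matroid M" "\<And>M. M \<in> S \<Longrightarrow> card (ground M) \<le> m"
  shows "finite (S // {(M, N). isomorphic M N})"
proof -
  let ?R = "{(M :: 'a set_system, N :: 'a set_system). isomorphic M N}"
  define h where "h M = (SOME h. bij_betw h (ground M) {..<card (ground M)})" for M :: "'a set_system"
  \<comment> \<open>The size is recorded as well, so that matroids with the same code are carried to
    the same set of numbers.\<close>
  define code where "code M = (card (ground M), (`) (h M) ` indeps M)" for M
  have h: "bij_betw (h M) (ground M) {..<card (ground M)}" if "M \<in> S" for M
  proof -
    have "\<exists>h. bij_betw h (ground M) {..<card (ground M)}"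
      using ex_bij_betw_finite_nat[OF matroid.finite_ground[OF S(1)[OF that]]]
      by (simp add: atLeast0LessThan)
    then show ?thesis unfolding h_def by (rule someI_ex)
  qed
  have "code ` S \<subseteq> {..m} \<times> Pow (Pow {..<m})"
  proof
    fix c assume "c \<in> code ` S"
    then obtain M where M: "M \<in> S" "c = code M" by auto
    have "h M ` I \<subseteq> {..<m}" if "I \<in> indeps M" for I
    proof -
      have "h M ` I \<subseteq> h M ` ground M"
        using matroid.indeps_subset[OF S(1)[OF M(1)] that] by (rule image_mono)
      also have "\<dots> \<subseteq> {..<m}" using h[OF M(1)] S(2)[OF M(1)] by (auto simp: bij_betw_def)
      finally show ?thesis .
    qed
    then show "c \<in> {..m} \<times> Pow (Pow {..<m})" using M S(2) by (auto simp: code_def)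
  qed
  then have fin: "finite (code ` S)" by (rule finite_subset) simp
  have eq: "?R `` {M} = ?R `` {N}" if "M \<in> S" "N \<in> S" "code M = code N" for M N
  proof (rule equiv_class_eq[OF equiv_isomorphic])
    have "isomorphic M N"
      by (rule isomorphic_if_same_image[OF S(1) S(1) h[OF that(1)]])
        (use that h[OF that(2)] in \<open>auto simp: code_def\<close>)
    then show "(M, N) \<in> ?R" by simp
  qed
  have "S // ?R \<subseteq> (\<lambda>c. ?R `` {inv_into S code c}) ` code ` S"
  proof
    fix X assume "X \<in> S // ?R"
    then obtain M where M: "M \<in> S" "X = ?R `` {M}" by (rule quotientE)
    have "?R `` {M} = ?R `` {inv_into S code (code M)}"
      using M(1) by (intro eq) (auto intro: inv_into_into simp: f_inv_into_f)
    with M show "X \<in> (\<lambda>c. ?R `` {inv_into S code c}) ` code ` S" by auto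
  qed
  then show ?thesis using fin finite_subset by blast
qed

theorem theorem3:
  fixes r :: nat
  assumes "r > 0"
  shows "finite ({M :: 'a set_system. excluded_minor quasi_graphic M \<and> rank M = r}
           // {(M, N). isomorphic M N})"
proof (rule finite_isomorphism_classes)
  fix M :: "'a set_system"
  assume "M \<in> {M. excluded_minor quasi_graphic M \<and> rank M = r}"
  then have M: "excluded_minor quasi_graphic M" "rank M = r" by simp_all
  show "matroid M" using M(1) by (simp add: excluded_minor_def)
  show "card (ground M) \<le> Suc (r + 4 ^ r * (Suc (r + 4 ^ r * (r + 2))))"
    using excluded_minor_quasi_graphic_card_le[OF M assms] .
qed

end
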